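(* Let $F : \{0,1\}^{\mathbb{Z}} \to \{0,1\}^{\mathbb{Z}}$ be the two-neighbor XOR automaton, $F(x)_i = x_i + x_{i+1} \bmod 2$, and let $0 \leq \alpha \leq 1$. There exists a shift-invariant, ergodic (with respect to the shift) probability measure $\mu$ of full support on $\{0,1\}^{\mathbb{Z}}$ such that the sequence $(F^{2^{n(n+1)/2}} \mu)_{n \in \mathbb{N}}$ weak-* converges to $\alpha \delta_0 + (1 - \alpha)\delta_1$, where for $a \in \{0,1\}$, $\delta_a$ denotes the Dirac measure concentrated on the constant configuration with all symbols equal to $a$.
   Context: For a word $w \in \{0,1\}^*$, the cylinder $[w]$ is the set of $x \in \{0,1\}^{\mathbb{Z}}$ with $x_0 \cdots x_{|w|-1} = w$. All probability measures are assumed shift-invariant. The image measure under a map $G$ (here an iterate of $F$) is $G\mu([u]) = \mu(G^{-1}([u]))$. A sequence of measures $\nu_n$ weak-* converges to $\nu$ if $\nu_n([u]) \to \nu([u])$ for every word $u$. A measure $\mu$ has full support if $\mu([u]) > 0$ for all words $u$. *)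

theory Defs
  imports "HOL-Probability.Probability" "HOL-Library.Z2"
begin

text \<open>Symbols are elements of the two-element field \<open>bit\<close>, so that addition of symbols is
  addition modulo 2.\<close>

type_synonym config = "int \<Rightarrow> bit"

text \<open>The Borel sigma-algebra of the full shift, as the product of the discrete one. Only the
  measurable structure of \<open>configs\<close> is used; its measure is irrelevant.\<close>

definition configs :: "config measure" where
  "configs = PiM UNIV (\<lambda>_. count_space UNIV)"

definition shift :: "config \<Rightarrow> config" where
  "shift x = (\<lambda>i. x (i + 1))"

definition xor_ca :: "config \<Rightarrow> config" where
  "xor_ca x = (\<lambda>i. x i + x (i + 1))"

definition cylinder :: "bit list \<Rightarrow> config set" where
  "cylinder w = {x. \<forall>i<length w. x (int i) = w ! i}"

definition config_measure :: "config measure \<Rightarrow> bool" where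
  "config_measure \<mu> \<longleftrightarrow> prob_space \<mu> \<and> sets \<mu> = sets configs"

definition shift_invariant :: "config measure \<Rightarrow> bool" where
  "shift_invariant \<mu> \<longleftrightarrow> distr \<mu> configs shift = \<mu>"

definition shift_ergodic :: "config measure \<Rightarrow> bool" where
  "shift_ergodic \<mu> \<longleftrightarrow>
     (\<forall>A\<in>sets \<mu>. shift -` A = A \<longrightarrow> measure \<mu> A = 0 \<or> measure \<mu> A = 1)"

definition full_support :: "config measure \<Rightarrow> bool" where
  "full_support \<mu> \<longleftrightarrow> (\<forall>u. measure \<mu> (cylinder u) > 0)"

definition weak_star_converges :: "(nat \<Rightarrow> config measure) \<Rightarrow> config measure \<Rightarrow> bool" where
  "weak_star_converges \<nu> \<nu>' \<longleftrightarrow>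
     (\<forall>u. (\<lambda>n. measure (\<nu> n) (cylinder u)) \<longlonglongrightarrow> measure \<nu>' (cylinder u))"

definition dirac_const :: "bit \<Rightarrow> config measure" where
  "dirac_const a = return configs (\<lambda>_. a)"

definition mixture :: "real \<Rightarrow> config measure \<Rightarrow> config measure \<Rightarrow> config measure" where
  "mixture \<alpha> M N = measure_of UNIV (sets configs)
     (\<lambda>A. ennreal \<alpha> * emeasure M A + ennreal (1 - \<alpha>) * emeasure N A)"

text \<open>The functions \<open>distr\<close> and \<open>measure_of\<close> silently yield a different measure when their
  side conditions fail; the following facts show that these conditions hold here.\<close>

lemma space_configs [simp]: "space configs = UNIV"
  by (simp add: configs_def space_PiM)

lemma measurable_coord [measurable]: "(\<lambda>x. x i) \<in> measurable configs (count_space UNIV)"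
  unfolding configs_def by measurable

lemma measurable_shift [measurable]: "shift \<in> measurable configs configs"
proof -
  have "shift \<in> measurable configs (PiM UNIV (\<lambda>_. count_space UNIV))"
    by (rule measurable_PiM_single') (auto simp: shift_def)
  then show ?thesis by (simp add: configs_def)
qed

lemma measurable_xor_ca [measurable]: "xor_ca \<in> measurable configs configs"
proof -
  have fin: "countable (UNIV :: bit set)"
    by (rule countable_subset[of _ "{0, 1}"]) auto
  have "(\<lambda>x. x i + x (i + 1)) \<in> measurable configs (count_space UNIV)" for i
    using measurable_compose_countable'[of UNIV "\<lambda>a x. a + x (i + 1)" configs
        "count_space UNIV" "\<lambda>x. x i"] fin
    by (auto intro: measurable_compose[OF measurable_coord])
  then have "xor_ca \<in> measurable configs (PiM UNIV (\<lambda>_. count_space UNIV))"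
    by (intro measurable_PiM_single') (auto simp: xor_ca_def)
  then show ?thesis by (simp add: configs_def)
qed

lemma measurable_xor_ca_funpow [measurable]: "(xor_ca ^^ k) \<in> measurable configs configs"
proof (induction k)
  case 0
  show ?case by (simp add: id_def)
next
  case (Suc k)
  show ?case unfolding funpow.simps by (rule measurable_comp[OF Suc measurable_xor_ca])
qed

lemma sets_cylinder [measurable]: "cylinder w \<in> sets configs"
proof -
  have "cylinder w = {x \<in> space configs. \<forall>i<length w. x (int i) = w ! i}"
    by (simp add: cylinder_def)
  also have "\<dots> \<in> sets configs"
    by measurable
  finally show ?thesis .
qed

lemma emeasure_mixture:
  assumes M: "sets M = sets configs" and N: "sets N = sets configs"
    and A: "A \<in> sets configs"
  shows "emeasure (mixture \<alpha> M N) A =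
    ennreal \<alpha> * emeasure M A + ennreal (1 - \<alpha>) * emeasure N A"
proof (rule emeasure_measure_of[OF mixture_def])
  show "sets configs \<subseteq> Pow UNIV" by simp
  show "A \<in> sets (mixture \<alpha> M N)"
    using A sets.sigma_sets_eq[of configs] by (simp add: mixture_def sets_measure_of)
  show "positive (sets (mixture \<alpha> M N))
     (\<lambda>A. ennreal \<alpha> * emeasure M A + ennreal (1 - \<alpha>) * emeasure N A)"
    by (simp add: positive_def)
  have sm: "sets (mixture \<alpha> M N) = sets configs"
    using sets.sigma_sets_eq[of configs] by (simp add: mixture_def sets_measure_of)
  show "countably_additive (sets (mixture \<alpha> M N))
     (\<lambda>A. ennreal \<alpha> * emeasure M A + ennreal (1 - \<alpha>) * emeasure N A)"
    unfolding countably_additive_def sm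
  proof (intro allI impI)
    fix B :: "nat \<Rightarrow> config set"
    assume B: "range B \<subseteq> sets configs" "disjoint_family B" "(\<Union>i. B i) \<in> sets configs"
    have "(\<Sum>i. ennreal \<alpha> * emeasure M (B i) + ennreal (1 - \<alpha>) * emeasure N (B i)) =
      ennreal \<alpha> * (\<Sum>i. emeasure M (B i)) + ennreal (1 - \<alpha>) * (\<Sum>i. emeasure N (B i))"
      by (simp add: suminf_add[symmetric])
    also have "\<dots> = ennreal \<alpha> * emeasure M (\<Union>i. B i) + ennreal (1 - \<alpha>) * emeasure N (\<Union>i. B i)"
      using B M N by (simp add: suminf_emeasure)
    finally show "(\<Sum>i. ennreal \<alpha> * emeasure M (B i) + ennreal (1 - \<alpha>) * emeasure N (B i)) =
      ennreal \<alpha> * emeasure M (\<Union>i. B i) + ennreal (1 - \<alpha>) * emeasure N (\<Union>i. B i)" .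
  qed
qed

end

theory Submission
  imports Defs
begin

text \<open>Since \<open>xor_ca ^^ (2 ^ k)\<close> maps \<open>x\<close> to \<open>x + \<sigma>\<^bsup>2^k\<^esup> x\<close>, we want a process in which, with \<open>L\<^sub>n = 2\<^bsup>n(n+1)/2\<^esup>\<close>,
  the window starting at \<open>L\<^sub>n\<close> is nearly always a copy or the complement of the window starting at 0,
  with probabilities tending to \<open>\<alpha>\<close> and \<open>1 - \<alpha>\<close>. Take the empirical measures of a generalised Morse
  sequence: the block of length \<open>L\<^sub>n\<^sub>+\<^sub>1 = 2\<^bsup>n+1\<^esup> L\<^sub>n\<close> is a concatenation of copies and complements of
  the block of length \<open>L\<^sub>n\<close>, in a pattern in which neighbours differ with frequency \<open>1 - \<alpha>\<close>; one slot
  is sacrificed to some word, which gives full support and costs only a proportion \<open>2\<^bsup>-n-1\<^esup>\<close>. Up to the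
  proportion \<open>2\<^bsup>-n\<^esup>\<close>, every later block is tiled by the \<open>n\<close>-th one and its complement. The second half
  of the pattern is the complement of the first, so a word has almost the same frequency in a block
  and in its complement; hence long averages are almost constant, which forces ergodicity.\<close>

section \<open>Local sets and limits of empirical measures\<close>

definition determined_by :: "int set \<Rightarrow> config set \<Rightarrow> bool" where
  "determined_by I A \<longleftrightarrow> (\<forall>x y. (\<forall>i\<in>I. x i = y i) \<longrightarrow> x \<in> A \<longrightarrow> y \<in> A)"

text \<open>These are the clopen sets. Unlike the cylinders they form an algebra, and they are
  stable under preimages by \<open>shift\<close>.\<close>

definition local_sets :: "config set set" where
  "local_sets = {A. \<exists>I. finite I \<and> determined_by I A}"

lemma determined_byD:
  assumes "determined_by I A" "\<And>i. i \<in> I \<Longrightarrow> x i = y i"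
  shows "x \<in> A \<longleftrightarrow> y \<in> A"
  using assms unfolding determined_by_def by metis

lemma determined_by_mono: "determined_by I A \<Longrightarrow> I \<subseteq> J \<Longrightarrow> determined_by J A"
  unfolding determined_by_def by blast

lemma determined_by_Compl: "determined_by I A \<Longrightarrow> determined_by I (- A)"
  unfolding determined_by_def by (metis ComplD ComplI)

lemma determined_by_Int: "determined_by I A \<Longrightarrow> determined_by I B \<Longrightarrow> determined_by I (A \<inter> B)"
  unfolding determined_by_def by blast

lemma determined_by_cylinder: "determined_by {0..<int (length u)} (cylinder u)"
  unfolding determined_by_def cylinder_def by fastforce

lemma cylinder_local: "cylinder u \<in> local_sets"
  unfolding local_sets_def using determined_by_cylinder by blast

lemma determined_by_shift: "determined_by I A \<Longrightarrow> determined_by ((\<lambda>i. i + 1) ` I) (shift -` A)"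
  unfolding determined_by_def shift_def by (auto simp: image_iff)

lemma shift_local: "A \<in> local_sets \<Longrightarrow> shift -` A \<in> local_sets"
  unfolding local_sets_def using determined_by_shift by blast

lemma algebra_local_sets: "algebra UNIV local_sets"
  unfolding algebra_iff_Int
proof (intro conjI ballI)
  show "{} \<in> local_sets" unfolding local_sets_def determined_by_def by auto
  fix a assume a: "a \<in> local_sets"
  then show "UNIV - a \<in> local_sets"
    unfolding local_sets_def using determined_by_Compl by (auto simp: Compl_eq_Diff_UNIV[symmetric])
  fix b assume "b \<in> local_sets"
  with a obtain I J where "finite (I \<union> J)" "determined_by I a" "determined_by J b"
    unfolding local_sets_def by auto
  then have "finite (I \<union> J)" "determined_by (I \<union> J) a" "determined_by (I \<union> J) b"
    using determined_by_mono by blast+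
  then show "a \<inter> b \<in> local_sets"
    unfolding local_sets_def using determined_by_Int by blast
qed auto

lemma finite_UNIV_bit: "finite (UNIV :: bit set)"
  by (rule finite_subset[of _ "{0, 1}"]) auto

text \<open>A local set is a finite union, over the restrictions of its points to \<open>I\<close>,
  of sets that prescribe the values on \<open>I\<close>.\<close>

lemma local_sets_measurable:
  assumes "A \<in> local_sets"
  shows "A \<in> sets configs"
proof -
  obtain I where I: "finite I" "determined_by I A" using assms by (auto simp: local_sets_def)
  define S where "S = (\<lambda>x. restrict x I) ` A"
  have "S \<subseteq> PiE I (\<lambda>_. UNIV)" by (auto simp: S_def)
  then have "finite S" using I finite_UNIV_bit finite_PiE finite_subset by metis
  have "A = (\<Union>a\<in>S. {x \<in> space configs. \<forall>i\<in>I. x i = a i})"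
  proof (intro subset_antisym subsetI)
    fix x assume "x \<in> A"
    then show "x \<in> (\<Union>a\<in>S. {x \<in> space configs. \<forall>i\<in>I. x i = a i})"
      by (auto simp: S_def intro!: bexI[of _ x])
  next
    fix x assume "x \<in> (\<Union>a\<in>S. {x \<in> space configs. \<forall>i\<in>I. x i = a i})"
    then obtain y where "y \<in> A" "\<forall>i\<in>I. x i = y i" by (auto simp: S_def)
    then show "x \<in> A" using I(2) unfolding determined_by_def by metis
  qed
  also have "\<dots> \<in> sets configs"
  proof (intro sets.finite_UN \<open>finite S\<close>)
    fix a
    show "{x \<in> space configs. \<forall>i\<in>I. x i = a i} \<in> sets configs"
      using I(1) by measurable
  qed
  finally show ?thesis .
qed

lemma sets_configs: "sets configs = sigma_sets UNIV local_sets"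
proof
  have "sets configs = sigma_sets UNIV {{f. f i \<in> A} |i A. True}"
    unfolding configs_def sets_PiM_single by simp
  also have "\<dots> \<subseteq> sigma_sets UNIV local_sets"
  proof (rule sigma_sets_mono', safe)
    fix i :: int and A :: "bit set"
    have "determined_by {i} {f. f i \<in> A}" by (auto simp: determined_by_def)
    then show "{f. f i \<in> A} \<in> local_sets" by (auto simp: local_sets_def)
  qed
  finally show "sets configs \<subseteq> sigma_sets UNIV local_sets" .
  show "sigma_sets UNIV local_sets \<subseteq> sets configs"
    using sets.sigma_sets_subset[of local_sets configs] local_sets_measurable by auto
qed

text \<open>The configuration space is compact by Tychonoff, and local sets are closed in it because
  their complements are open. This supplies the continuity at the empty set from which countable
  additivity follows.\<close>

lemma local_sets_decseq_empty:
  assumes "range A \<subseteq> local_sets" "decseq A" "(\<Inter>n. A n) = {}"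
  shows "\<exists>n. A n = {}"
proof (rule ccontr)
  assume ne: "\<not> ?thesis"
  define T where "T = product_topology (\<lambda>_::int. discrete_topology (UNIV :: bit set)) UNIV"
  have top: "topspace T = UNIV" by (simp add: T_def)
  have op: "openin T B" if "B \<in> local_sets" for B
  proof -
    obtain I where I: "finite I" "determined_by I B" using \<open>B \<in> local_sets\<close> by (auto simp: local_sets_def)
    have "\<exists>U. openin T U \<and> x \<in> U \<and> U \<subseteq> B" if "x \<in> B" for x
    proof (intro exI conjI)
      define S where "S = (\<lambda>i. if i \<in> I then {x i} else UNIV)"
      have "finite {i. S i \<noteq> UNIV}" by (rule finite_subset[OF _ I(1)]) (auto simp: S_def)
      then show "openin T (PiE UNIV S)"
        unfolding T_def openin_PiE_gen by simp
      show "x \<in> PiE UNIV S" by (auto simp: S_def)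
      show "PiE UNIV S \<subseteq> B"
      proof
        fix y assume y: "y \<in> PiE UNIV S"
        have "x i = y i" if "i \<in> I" for i using PiE_mem[OF y, of i] that by (auto simp: S_def)
        then show "y \<in> B" using I(2) \<open>x \<in> B\<close> unfolding determined_by_def by blast
      qed
    qed
    then show ?thesis using openin_subopen[of T B] by blast
  qed
  have "(\<Inter>n. A n) \<noteq> {}"
  proof (rule compact_space_imp_nest)
    show "compact_space T"
      unfolding T_def compact_space_product_topology
      by (simp add: compact_space_discrete_topology finite_UNIV_bit)
    fix n
    have "UNIV - A n \<in> local_sets"
      using assms(1) algebra_local_sets unfolding algebra_iff_Int by blast
    then show "closedin T (A n)" using op unfolding closedin_def top by auto
  qed (use assms ne in auto)
  then show False using assms by simp
qed

section \<open>Empirical measures of orbits and their limits\<close>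

definition visit_freq :: "nat \<Rightarrow> config \<Rightarrow> config set \<Rightarrow> real" where
  "visit_freq N x A = real (card {p. p < N \<and> (shift ^^ p) x \<in> A}) / real N"

lemma visit_freq_bounds: "0 \<le> visit_freq N x A" "visit_freq N x A \<le> 1"
proof -
  have "card {p. p < N \<and> (shift ^^ p) x \<in> A} \<le> card {..<N}" by (rule card_mono) auto
  then show "visit_freq N x A \<le> 1" by (auto simp: visit_freq_def divide_le_eq)
qed (auto simp: visit_freq_def)

lemma visit_freq_Un: "A \<inter> B = {} \<Longrightarrow> visit_freq N x (A \<union> B) = visit_freq N x A + visit_freq N x B"
proof -
  assume "A \<inter> B = {}"
  then have "card {p. p < N \<and> (shift ^^ p) x \<in> A \<union> B} =
      card {p. p < N \<and> (shift ^^ p) x \<in> A} + card {p. p < N \<and> (shift ^^ p) x \<in> B}"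
    by (subst card_Un_disjoint[symmetric]) (auto intro!: arg_cong[where f = card])
  then show ?thesis by (simp add: visit_freq_def add_divide_distrib)
qed

lemma visit_freq_UNIV: "N > 0 \<Longrightarrow> visit_freq N x UNIV = 1"
  by (simp add: visit_freq_def)

text \<open>The two counts concern the times \<open>1\<close> to \<open>N\<close> and
  \<open>0\<close> to \<open>N - 1\<close>, so they differ by at most one.\<close>

lemma visit_freq_shift: "\<bar>visit_freq N x (shift -` A) - visit_freq N x A\<bar> \<le> 1 / real N"
proof -
  define S where "S k = {p. p < N \<and> (shift ^^ (p + k)) x \<in> A}" for k
  have sub1: "Suc ` S 1 \<subseteq> insert N (S 0)" by (auto simp: S_def)
  have "card (S 1) = card (Suc ` S 1)" by (simp add: card_image)
  also have "\<dots> \<le> card (insert N (S 0))" by (rule card_mono[OF _ sub1]) (auto simp: S_def)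
  also have "\<dots> \<le> Suc (card (S 0))" by (rule card_insert_le_m1) auto
  finally have 1: "card (S 1) \<le> Suc (card (S 0))" .
  have sub2: "S 0 \<subseteq> insert 0 (Suc ` S 1)"
  proof
    fix p assume "p \<in> S 0"
    then show "p \<in> insert 0 (Suc ` S 1)" by (cases p) (auto simp: S_def)
  qed
  have "card (S 0) \<le> card (insert 0 (Suc ` S 1))" by (rule card_mono[OF _ sub2]) (auto simp: S_def)
  also have "\<dots> \<le> Suc (card (Suc ` S 1))" by (rule card_insert_le_m1) auto
  also have "card (Suc ` S 1) = card (S 1)" by (simp add: card_image)
  finally have 2: "card (S 0) \<le> Suc (card (S 1))" .
  have "visit_freq N x (shift -` A) = real (card (S 1)) / N" "visit_freq N x A = real (card (S 0)) / N"
    by (auto simp: visit_freq_def S_def)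
  moreover have "\<bar>real (card (S 1)) - real (card (S 0))\<bar> \<le> 1" using 1 2 by linarith
  ultimately show ?thesis
    by (simp add: diff_divide_distrib[symmetric] abs_divide divide_right_mono)
qed

text \<open>Tychonoff provides a limit along a filter for uncountably many sequences simultaneously, which
  spares the extraction of diagonal subsequences.\<close>

lemma cluster_filter:
  fixes f :: "nat \<Rightarrow> 'a \<Rightarrow> real"
  assumes "\<And>n a. f n a \<in> {0..1}"
  shows "\<exists>G l. G \<noteq> bot \<and> G \<le> sequentially \<and> (\<forall>a. ((\<lambda>n. f n a) \<longlongrightarrow> l a) G)"
proof -
  define K :: "('a \<Rightarrow> real) set" where "K = PiE UNIV (\<lambda>_. {0..1})"
  have "compactin (product_topology (\<lambda>_. euclidean) UNIV) K"
    unfolding K_def compactin_PiE by simp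
  then have "compact K" by (simp add: euclidean_product_topology)
  moreover have "filtermap f sequentially \<noteq> bot" by (simp add: filtermap_bot_iff)
  moreover have "eventually (\<lambda>x. x \<in> K) (filtermap f sequentially)"
    using assms by (simp add: eventually_filtermap K_def PiE_iff)
  ultimately obtain l where l: "inf (nhds l) (filtermap f sequentially) \<noteq> bot"
    unfolding compact_filter by blast
  \<comment> \<open>A cluster point only makes the neighbourhoods of \<open>l\<close> meet the image
    filter. Pulling them back to the indices and refining by \<open>sequentially\<close> turns this
    into convergence.\<close>
  define G where "G = inf (filtercomap f (nhds l)) sequentially"
  have "G \<noteq> bot"
  proof
    assume "G = bot"
    then have "eventually (\<lambda>_. False) G" by simp
    then obtain P Q where PQ: "eventually P (filtercomap f (nhds l))" "eventually Q sequentially"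
      "\<And>x. P x \<Longrightarrow> Q x \<Longrightarrow> False" unfolding G_def eventually_inf by blast
    then obtain R where R: "eventually R (nhds l)" "\<And>x. R (f x) \<Longrightarrow> P x"
      by (auto simp: eventually_filtercomap)
    have "eventually (\<lambda>y. \<not> R y) (filtermap f sequentially)"
      unfolding eventually_filtermap using PQ(2) by eventually_elim (use PQ(3) R(2) in blast)
    with R(1) have "eventually (\<lambda>_. False) (inf (nhds l) (filtermap f sequentially))"
      unfolding eventually_inf by blast
    with l show False by simp
  qed
  moreover have "G \<le> sequentially" by (simp add: G_def)
  moreover have "((\<lambda>n. f n a) \<longlongrightarrow> l a) G" for a
  proof -
    have "filterlim f (nhds l) G"
      unfolding G_def filterlim_def using filtermap_filtercomap filtermap_mono
      by (metis inf_le1 order_trans)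
    moreover have "((\<lambda>y. y a) \<longlongrightarrow> l a) (nhds l)"
    proof (rule topological_tendstoI)
      fix S :: "real set" assume "open S" "l a \<in> S"
      then have "open ((\<lambda>y :: 'a \<Rightarrow> real. y a) -` S)"
        by (intro open_vimage continuous_on_product_coordinates)
      then show "eventually (\<lambda>y. y a \<in> S) (nhds l)"
        using eventually_nhds_in_open[of "(\<lambda>y. y a) -` S" l] \<open>l a \<in> S\<close> by simp
    qed
    ultimately show ?thesis by (rule filterlim_compose[rotated])
  qed
  ultimately show ?thesis by blast
qed

text \<open>Krylov-Bogolyubov: the limiting frequencies are additive, and shift-invariant because
  the error \<open>1 / N m\<close> vanishes. The starting point \<open>x m\<close> may change with
  \<open>m\<close>.\<close>

lemma ex_empirical_limit:
  fixes N :: "nat \<Rightarrow> nat" and x :: "nat \<Rightarrow> config"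
  assumes N: "filterlim N at_top sequentially"
  shows "\<exists>G \<mu>. G \<noteq> bot \<and> G \<le> sequentially \<and> config_measure \<mu> \<and> shift_invariant \<mu> \<and>
    (\<forall>A\<in>local_sets. ((\<lambda>m. visit_freq (N m) (x m) A) \<longlongrightarrow> measure \<mu> A) G)"
proof -
  obtain G l where G: "G \<noteq> bot" "G \<le> sequentially"
    and l: "\<And>A. ((\<lambda>m. visit_freq (N m) (x m) A) \<longlongrightarrow> l A) G"
    using cluster_filter[of "\<lambda>m A. visit_freq (N m) (x m) A"] visit_freq_bounds by auto
  have l_nonneg: "0 \<le> l A" for A
    by (rule tendsto_lowerbound[OF l _ G(1)]) (simp add: visit_freq_bounds)
  have l_Un: "l (A \<union> B) = l A + l B" if "A \<inter> B = {}" for A B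
    using tendsto_unique[OF G(1) l[of "A \<union> B"]] tendsto_add[OF l l, of A B] visit_freq_Un[OF that] by simp
  have N': "filterlim N at_top G" using filterlim_mono[OF N order_refl G(2)] .
  have "eventually (\<lambda>m. visit_freq (N m) (x m) UNIV = 1) G"
    using N'[unfolded filterlim_at_top, rule_format, of 1]
    by eventually_elim (simp add: visit_freq_UNIV)
  then have l_UNIV: "l UNIV = 1"
    using tendsto_unique[OF G(1) l[of UNIV]] tendsto_eventually by metis
  have l_empty: "l {} = 0" using l_Un[of "{}" "{}"] by simp
  have l_shift: "l (shift -` A) = l A" for A
  proof -
    have "((\<lambda>m. 1 / real (N m)) \<longlongrightarrow> 0) G"
      by (intro tendsto_divide_0[OF tendsto_const] filterlim_at_top_imp_at_infinity
          filterlim_compose[OF filterlim_real_sequentially N'])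
    then have "((\<lambda>m. visit_freq (N m) (x m) (shift -` A) - visit_freq (N m) (x m) A) \<longlongrightarrow> 0) G"
      by (rule Lim_null_comparison[rotated]) (use visit_freq_shift in auto)
    moreover have "((\<lambda>m. visit_freq (N m) (x m) (shift -` A) - visit_freq (N m) (x m) A)
        \<longlongrightarrow> l (shift -` A) - l A) G" by (intro tendsto_diff l)
    ultimately show ?thesis using tendsto_unique[OF G(1)] by fastforce
  qed
  interpret algebra UNIV local_sets by (rule algebra_local_sets)
  \<comment> \<open>The limit \<open>l\<close> is additive on all sets, but compactness gives
    continuity only on the local ones; the measure is extended from there by Caratheodory's
    theorem.\<close>
  have "\<exists>m :: config set \<Rightarrow> ennreal. (\<forall>s \<in> local_sets. m s = ennreal (l s)) \<and>
      measure_space UNIV (sigma_sets UNIV local_sets) m"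
  proof (rule caratheodory_empty_continuous)
    show "positive local_sets (\<lambda>s. ennreal (l s))" by (simp add: positive_def l_empty)
    show "additive local_sets (\<lambda>s. ennreal (l s))"
      by (auto simp: additive_def l_Un l_nonneg ennreal_plus)
    fix A :: "nat \<Rightarrow> config set"
    assume A: "range A \<subseteq> local_sets" "decseq A" "(\<Inter>i. A i) = {}"
    then obtain n where n: "A n = {}" using local_sets_decseq_empty by blast
    have "eventually (\<lambda>i. ennreal (l (A i)) = 0) sequentially"
      using eventually_ge_at_top[of n]
    proof eventually_elim
      case (elim i)
      then have "A i = {}" using n decseqD[OF A(2)] by blast
      then show ?case by (simp add: l_empty)
    qed
    then show "(\<lambda>i. ennreal (l (A i))) \<longlonglongrightarrow> 0" by (rule tendsto_eventually)
  qed simp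
  then obtain m :: "config set \<Rightarrow> ennreal" where m: "\<And>s. s \<in> local_sets \<Longrightarrow> m s = ennreal (l s)"
    and ms: "measure_space UNIV (sigma_sets UNIV local_sets) m" by blast
  define \<mu> where "\<mu> = measure_of UNIV local_sets m"
  have sets: "sets \<mu> = sets configs" by (simp add: \<mu>_def sets_configs sets_measure_of)
  have sp: "space \<mu> = UNIV" by (simp add: \<mu>_def)
  have em: "emeasure \<mu> A = ennreal (l A)" if "A \<in> local_sets" for A
    using emeasure_measure_of_sigma[of UNIV "sigma_sets UNIV local_sets" m A] ms that m
    unfolding \<mu>_def measure_space_def
    by (simp add: emeasure_measure_of[OF refl] measure_space_def)
  have "prob_space \<mu>"
    by (rule prob_spaceI) (simp add: sp em top l_UNIV)
  have mshift: "shift \<in> measurable \<mu> configs"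
    using measurable_shift unfolding measurable_cong_sets[OF sets refl] .
  note \<open>prob_space \<mu>\<close>
  moreover have "distr \<mu> configs shift = \<mu>"
  proof (rule measure_eqI_generator_eq[of local_sets UNIV])
    show "Int_stable local_sets" by (auto simp: Int_stable_def)
    fix A assume A: "A \<in> local_sets"
    have "emeasure (distr \<mu> configs shift) A = emeasure \<mu> (shift -` A \<inter> space \<mu>)"
      using A local_sets_measurable by (intro emeasure_distr mshift) auto
    then show "emeasure (distr \<mu> configs shift) A = emeasure \<mu> A"
      using A by (simp add: sp em shift_local l_shift)
  next
    have "emeasure (distr \<mu> configs shift) UNIV \<le> 1"
      using prob_space.prob_space_distr[OF \<open>prob_space \<mu>\<close>, of shift configs]
        measurable_cong_sets[OF sets refl] measurable_shift prob_space.emeasure_space_1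
      by (metis order_refl space_configs space_distr)
    then show "emeasure (distr \<mu> configs shift) UNIV \<noteq> \<infinity>" by (auto simp: top_unique)
    show "range (\<lambda>_::nat. UNIV) \<subseteq> local_sets" by auto
  qed (auto simp: sets sets_configs)
  moreover have "measure \<mu> A = l A" if "A \<in> local_sets" for A
    using em[OF that] l_nonneg by (simp add: measure_def)
  ultimately show ?thesis
    using G l sets unfolding config_measure_def shift_invariant_def
    by (intro exI[of _ G] exI[of _ \<mu>]) auto
qed

section \<open>Blocks and their tilings\<close>

text \<open>The lengths are powers of two, at which the iterates of \<open>xor_ca\<close> have just
  two terms. The quotients \<open>2 ^ Suc n\<close> of consecutive lengths make the sacrificed
  proportions summable.\<close>

definition block_len :: "nat \<Rightarrow> nat" where
  "block_len n = 2 ^ (n * (n + 1) div 2)"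

text \<open>The parity of \<open>\<lfloor>\<beta> * j\<rfloor>\<close> changes at a proportion \<open>\<beta>\<close> of the positions \<open>j\<close>; the second half of
  the pattern complements the first one.\<close>

definition pattern :: "real \<Rightarrow> nat \<Rightarrow> nat \<Rightarrow> bit" where
  "pattern \<beta> n j = of_bool (odd \<lfloor>\<beta> * real (j mod 2 ^ n)\<rfloor>) + of_bool (2 ^ n \<le> j)"

text \<open>The enumeration of pairs makes every word the \<open>w\<close> of infinitely many \<open>n\<close>, in particular of some
  \<open>n\<close> with \<open>length w \<le> block_len n\<close>.\<close>

definition filler :: "nat \<Rightarrow> nat \<Rightarrow> bit" where
  "filler n p = (let w = fst (from_nat n :: bool list \<times> nat) in of_bool (p < length w \<and> w ! p))"

text \<open>Only the positions \<open>p < block_len n\<close> of \<open>block \<beta> n\<close> are meaningful.\<close>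

primrec block :: "real \<Rightarrow> nat \<Rightarrow> nat \<Rightarrow> bit" where
  "block \<beta> 0 p = 0"
| "block \<beta> (Suc n) p = (if p < block_len n then filler n p
     else block \<beta> n (p mod block_len n) + pattern \<beta> n (p div block_len n))"

text \<open>Adding \<open>s = 1\<close> complements the configuration. \<open>nat\<close> sends
  every negative coordinate to position \<open>0\<close>.\<close>

definition block_config :: "real \<Rightarrow> nat \<Rightarrow> bit \<Rightarrow> config" where
  "block_config \<beta> n s = (\<lambda>i. block \<beta> n (nat i) + s)"

text \<open>The sign \<open>s\<close> is \<open>0\<close> for a copy of the block of level
  \<open>n\<close> and \<open>1\<close> for its complement.\<close>

definition good_tile :: "real \<Rightarrow> nat \<Rightarrow> nat \<Rightarrow> nat \<Rightarrow> bool" where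
  "good_tile \<beta> n m t \<longleftrightarrow>
    (\<exists>s. \<forall>r<block_len n. block \<beta> m (t * block_len n + r) = block \<beta> n r + s)"

lemma bit_add_self [simp]: "x + x = (0 :: bit)"
  by (cases x) auto

lemma bit_add_self_left [simp]: "x + (x + y) = (y :: bit)"
  by (cases x; cases y) auto

lemma block_len_pos [simp]: "0 < block_len n"
  by (simp add: block_len_def)

lemma block_len_Suc: "block_len (Suc n) = 2 ^ Suc n * block_len n"
proof -
  have "Suc n * (Suc n + 1) = n * (n + 1) + Suc n * 2" by simp
  then have "Suc n * (Suc n + 1) div 2 = n * (n + 1) div 2 + Suc n"
    using div_mult_self1[of 2 "n * (n + 1)" "Suc n"] by (simp only: add.commute)
  then show ?thesis by (simp only: block_len_def power_add mult.commute)
qed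

lemma power_le_block_len: "2 ^ n \<le> block_len n"
proof (cases n)
  case (Suc k)
  then show ?thesis using block_len_pos[of k] by (simp add: block_len_Suc Suc_leI)
qed (simp add: block_len_def)

lemma less_block_len: "n < block_len n"
  using power_le_block_len[of n] less_exp[of n] by linarith

lemma block_len_tendsto: "filterlim block_len at_top sequentially"
  by (rule filterlim_at_top_mono[OF filterlim_ident]) (simp add: less_imp_le less_block_len)

lemma pattern_add_half: "j < 2 ^ n \<Longrightarrow> pattern \<beta> n (j + 2 ^ n) = pattern \<beta> n j + 1"
  by (simp add: pattern_def)

text \<open>Slot \<open>0\<close> holds the filler, hence \<open>1 \<le> j\<close>.\<close>

lemma block_Suc_slot:
  assumes "1 \<le> j" "r < block_len n"
  shows "block \<beta> (Suc n) (j * block_len n + r) = block \<beta> n r + pattern \<beta> n j"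
proof -
  have "block_len n \<le> j * block_len n" using assms by simp
  then have "\<not> j * block_len n + r < block_len n" by linarith
  then show ?thesis using assms by simp
qed

lemma funpow_shift: "(shift ^^ p) x = (\<lambda>i. x (i + int p))"
  by (induction p arbitrary: x) (auto simp: shift_def funpow_Suc_right algebra_simps simp del: funpow.simps)

text \<open>Passing from level \<open>m\<close> to \<open>Suc m\<close> spoils at most the tiles of
  slot \<open>0\<close>, a proportion \<open>1 / 2 ^ Suc m\<close>; every other slot repeats the
  block of level \<open>m\<close> up to sign. These proportions, summed from level \<open>n\<close>
  on, telescope to the bound. Divisibility is carried along so that tiles align with slots.\<close>

lemma card_bad_tiles:
  fixes \<beta> :: real
  defines "bad n d \<equiv> {t. t < block_len (n + d) div block_len n \<and> \<not> good_tile \<beta> n (n + d) t}"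
  shows "block_len n dvd block_len (n + d) \<and>
    real (card (bad n d)) \<le> (1 / 2 ^ n - 1 / 2 ^ (n + d)) * real (block_len (n + d) div block_len n)"
proof (induction d)
  case 0
  have "good_tile \<beta> n n 0" by (auto simp: good_tile_def intro!: exI[of _ 0])
  then have "bad n 0 = {}" by (auto simp: bad_def) (metis neq0_conv)
  then show ?case by simp
next
  case (Suc d)
  define m where "m = n + d"
  define L where "L = block_len n"
  define T where "T = block_len m div L"
  define q :: nat where "q = 2 ^ Suc m"
  have Lpos: "0 < L" by (simp add: L_def)
  have dvd: "block_len m = T * L" using Suc by (simp add: T_def L_def m_def)
  then have len: "block_len (Suc m) = q * T * L" by (simp add: block_len_Suc q_def)
  have Tpos: "0 < T" using dvd block_len_pos[of m] by (cases T) auto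
  have good: "good_tile \<beta> n (Suc m) (j * T + t)" if "1 \<le> j" "t < T" "good_tile \<beta> n m t" for j t
  proof -
    obtain s where s: "\<And>r. r < L \<Longrightarrow> block \<beta> m (t * L + r) = block \<beta> n r + s"
      using \<open>good_tile \<beta> n m t\<close> by (auto simp: good_tile_def L_def)
    have "block \<beta> (Suc m) ((j * T + t) * L + r) = block \<beta> n r + (s + pattern \<beta> m j)" if "r < L" for r
    proof -
      have "t * L + r < Suc t * L" using that by simp
      also have "\<dots> \<le> T * L" using \<open>t < T\<close> by (intro mult_right_mono) auto
      finally have "t * L + r < block_len m" by (simp add: dvd)
      note slot = block_Suc_slot[OF \<open>1 \<le> j\<close> this, of \<beta>]
      have "(j * T + t) * L + r = j * block_len m + (t * L + r)" by (simp add: dvd algebra_simps)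
      then show ?thesis by (simp only: slot s[OF that] add.assoc)
    qed
    then show ?thesis unfolding good_tile_def L_def by blast
  qed
  \<comment> \<open>A bad tile lies in slot \<open>0\<close>, or it comes, in a later slot, from a
    bad tile of the block of level \<open>m\<close>.\<close>
  have "bad n (Suc d) \<subseteq> {..<T} \<union> (\<lambda>(j, t). j * T + t) ` ({1..<q} \<times> bad n d)"
  proof
    fix t assume t: "t \<in> bad n (Suc d)"
    then have tq: "t < q * T" "\<not> good_tile \<beta> n (Suc m) t"
      using len Lpos by (auto simp: bad_def m_def L_def)
    show "t \<in> {..<T} \<union> (\<lambda>(j, t). j * T + t) ` ({1..<q} \<times> bad n d)"
    proof (cases "t < T")
      case False
      define j where "j = t div T"
      have j: "1 \<le> j" "j < q" "t = j * T + t mod T"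
        using False Tpos tq by (auto simp: j_def div_greater_zero_iff less_mult_imp_div_less Suc_le_eq)
      have "t mod T < T" using Tpos by simp
      then have "\<not> good_tile \<beta> n m (t mod T)" using good[of j "t mod T"] j tq by metis
      then have "t mod T \<in> bad n d" using Tpos by (simp add: bad_def m_def T_def L_def)
      then show ?thesis using j by (intro UnI2 image_eqI[of _ _ "(j, t mod T)"]) auto
    qed simp
  qed
  then have "card (bad n (Suc d)) \<le> card ({..<T} \<union> (\<lambda>(j, t). j * T + t) ` ({1..<q} \<times> bad n d))"
    by (rule card_mono[rotated]) (auto simp: bad_def)
  also have "\<dots> \<le> card {..<T} + card ((\<lambda>(j, t). j * T + t) ` ({1..<q} \<times> bad n d))"
    by (rule card_Un_le)
  also have "\<dots> \<le> T + (q - 1) * card (bad n d)"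
    using card_image_le[of "{1..<q} \<times> bad n d" "\<lambda>(j, t). j * T + t"]
    by (simp add: card_cartesian_product bad_def)
  also have "\<dots> \<le> T + q * card (bad n d)" by simp
  finally have "real (card (bad n (Suc d))) \<le> real (T + q * card (bad n d))" by (rule of_nat_mono)
  also have "\<dots> = T + real q * card (bad n d)" by simp
  also have "\<dots> \<le> T + real q * ((1 / 2 ^ n - 1 / 2 ^ m) * T)"
    using Suc by (intro add_left_mono mult_left_mono) (auto simp: m_def T_def L_def)
  also have "\<dots> = (1 / 2 ^ n - 1 / 2 ^ Suc m) * (real q * T)"
    by (simp add: q_def field_simps)
  finally show ?case using len Lpos by (simp add: m_def L_def)
qed

lemma block_len_mono_dvd: "n \<le> m \<Longrightarrow> block_len n dvd block_len m"
  using card_bad_tiles[of n "m - n" 0] by simp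

lemma card_bad_tiles_le:
  assumes "n \<le> m"
  shows "real (card {t. t < block_len m div block_len n \<and> \<not> good_tile \<beta> n m t})
    \<le> real (block_len m div block_len n) / 2 ^ n"
proof -
  have "(1 / 2 ^ n - 1 / 2 ^ m) * real (block_len m div block_len n)
      \<le> (1 / 2 ^ n) * real (block_len m div block_len n)" by (intro mult_right_mono) auto
  then show ?thesis using card_bad_tiles[of n "m - n" \<beta>] assms by simp
qed

text \<open>The bound on \<open>r + w\<close> keeps the window inside the tile, where the two
  configurations agree.\<close>

lemma good_tile_visit:
  assumes s: "\<And>r. r < block_len n \<Longrightarrow> block \<beta> m (t * block_len n + r) = block \<beta> n r + s"
    and A: "determined_by {0..<int w} A" and r: "r + w \<le> block_len n"
  shows "(shift ^^ (t * block_len n + r)) (block_config \<beta> m 0) \<in> A \<longleftrightarrow>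
    (shift ^^ r) (block_config \<beta> n s) \<in> A"
proof (rule determined_byD[OF A])
  fix i assume i: "i \<in> {0..<int w}"
  define k where "k = nat i"
  have i': "i = int k" "r + k < block_len n" using i r by (auto simp: k_def)
  show "(shift ^^ (t * block_len n + r)) (block_config \<beta> m 0) i = (shift ^^ r) (block_config \<beta> n s) i"
    using s[OF i'(2)] unfolding funpow_shift block_config_def i'(1)
    by (simp flip: of_nat_add of_nat_mult add: nat_int add_ac)
qed

text \<open>At least a proportion \<open>1 - 1 / 2 ^ n\<close> of the tiles is good, and each good
  tile contributes at least \<open>c\<close> visits. The count \<open>c\<close> must serve both
  signs, because a good tile may be a copy or a complement.\<close>

lemma visit_freq_block_ge:
  assumes "n \<le> m" and A: "determined_by {0..<int w} A"
    and c: "\<And>s. c \<le> card {r. r + w \<le> block_len n \<and> r < block_len n \<and> (shift ^^ r) (block_config \<beta> n s) \<in> A}"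
  shows "(1 - 1 / 2 ^ n) * (real c / real (block_len n))
    \<le> visit_freq (block_len m) (block_config \<beta> m 0) A"
proof -
  define L where "L = block_len n"
  define T where "T = block_len m div L"
  have Lpos: "0 < L" by (simp add: L_def)
  have len: "block_len m = T * L" using block_len_mono_dvd[OF assms(1)] by (simp add: T_def L_def)
  have Tpos: "0 < T" using len block_len_pos[of m] by (cases T) auto
  define good where "good = {t. t < T \<and> good_tile \<beta> n m t}"
  have "\<exists>s. \<forall>t\<in>good. \<forall>r<L. block \<beta> m (t * L + r) = block \<beta> n r + s t"
    using bchoice[of good "\<lambda>t s. \<forall>r<L. block \<beta> m (t * L + r) = block \<beta> n r + s"]
    by (auto simp: good_def good_tile_def L_def)
  then obtain s where s: "\<And>t r. t \<in> good \<Longrightarrow> r < L \<Longrightarrow> block \<beta> m (t * L + r) = block \<beta> n r + s t"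
    by blast
  \<comment> \<open>The condition \<open>r < L\<close> makes the times \<open>t * L + r\<close> of
    different tiles distinct, also when \<open>w = 0\<close>.\<close>
  define R where "R t = {r. r + w \<le> L \<and> r < L \<and> (shift ^^ r) (block_config \<beta> n (s t)) \<in> A}" for t
  have fR: "finite (R t)" for t by (rule finite_subset[of _ "{..<L}"]) (auto simp: R_def)
  have "card {t. t < T \<and> \<not> good_tile \<beta> n m t} + card good = T"
    by (subst card_Un_disjoint[symmetric])
      (auto simp: good_def intro!: trans[OF arg_cong[where f = card] card_lessThan])
  then have "(1 - 1 / 2 ^ n) * real T \<le> card good"
    using card_bad_tiles_le[OF assms(1), of \<beta>] by (simp add: T_def L_def algebra_simps)
  then have "(1 - 1 / 2 ^ n) * real T * c \<le> real (card good) * c" by (rule mult_right_mono) simp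
  also have "\<dots> = real (\<Sum>t\<in>good. c)" by simp
  also have "\<dots> \<le> real (\<Sum>t\<in>good. card (R t))"
    using c by (intro of_nat_mono sum_mono) (simp add: R_def L_def)
  also have "(\<Sum>t\<in>good. card (R t)) = card (Sigma good R)"
    using fR by (subst card_SigmaI) (auto simp: good_def)
  also have "\<dots> = card ((\<lambda>(t, r). t * L + r) ` Sigma good R)"
  proof (rule card_image[symmetric], rule inj_onI, clarsimp)
    fix t r t' r' assume "r \<in> R t" "r' \<in> R t'" and eq: "t * L + r = t' * L + r'"
    then have "r < L" "r' < L" by (auto simp: R_def)
    then show "t = t' \<and> r = r'" using arg_cong[OF eq, of "\<lambda>x. x div L"] arg_cong[OF eq, of "\<lambda>x. x mod L"] by simp
  qed
  also have "real \<dots> \<le> card {p. p < block_len m \<and> (shift ^^ p) (block_config \<beta> m 0) \<in> A}"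
  proof (intro of_nat_mono card_mono)
    show "(\<lambda>(t, r). t * L + r) ` Sigma good R \<subseteq>
      {p. p < block_len m \<and> (shift ^^ p) (block_config \<beta> m 0) \<in> A}"
    proof clarsimp
      fix t r assume t: "t \<in> good" and r: "r \<in> R t"
      have "t * L + r < Suc t * L" using r by (simp add: R_def)
      also have "\<dots> \<le> T * L" using t by (intro mult_right_mono) (auto simp: good_def)
      finally have "t * L + r < block_len m" by (simp add: len)
      moreover have "(shift ^^ (t * L + r)) (block_config \<beta> m 0) \<in> A"
        using good_tile_visit[of n \<beta> m t "s t" w A r] s[OF t] r A by (auto simp: R_def L_def)
      ultimately show "t * L + r < block_len m \<and> (shift ^^ (t * L + r)) (block_config \<beta> m 0) \<in> A" ..
    qed
  qed simp
  also have "(1 - 1 / 2 ^ n) * real T * real c = (1 - 1 / 2 ^ n) * (real c / L) * block_len m"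
    using Lpos by (simp add: len)
  finally show ?thesis
    unfolding visit_freq_def by (subst pos_le_divide_eq) (simp_all add: L_def)
qed

section \<open>Averages over long windows\<close>

lemma sum_mult_group:
  fixes f :: "nat \<Rightarrow> 'a::comm_monoid_add"
  shows "(\<Sum>p<T * L. f p) = (\<Sum>t<T. \<Sum>r<L. f (t * L + r))"
proof -
  have "sum f {t * L..<t * L + L} = (\<Sum>r<L. f (t * L + r))" for t
    using sum.shift_bounds_nat_ivl[of f 0 "t * L" L] by (simp add: add.commute lessThan_atLeast0)
  then show ?thesis using sum.nat_group[of f L T] by simp
qed

text \<open>Sliding a window of length \<open>K * L\<close> to the nearest tile boundary changes its sum by at most
  \<open>2 * L\<close>; an aligned window is a union of \<open>K\<close> tiles.\<close>

lemma window_sum_bound: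
  fixes g :: "nat \<Rightarrow> real"
  assumes g: "\<And>i. \<bar>g i\<bar> \<le> 1"
  shows "(\<Sum>p<T * L. \<bar>\<Sum>i<K * L. g (p + i)\<bar>) \<le>
    2 * real L * (real T * L) + real L * (real K * ((\<Sum>t<T. \<bar>\<Sum>r<L. g (t * L + r)\<bar>) + real K * L))"
proof -
  define S where "S p = (\<Sum>i<K * L. g (p + i))" for p
  define \<tau> where "\<tau> t = \<bar>\<Sum>r<L. g (t * L + r)\<bar>" for t
  have \<tau>_le: "\<tau> t \<le> L" for t
  proof -
    have "\<tau> t \<le> (\<Sum>r<L. \<bar>g (t * L + r)\<bar>)" unfolding \<tau>_def by (rule sum_abs)
    also have "\<dots> \<le> (\<Sum>r<L. 1)" by (intro sum_mono g)
    finally show ?thesis by simp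
  qed
  \<comment> \<open>Each unit step drops one term and adds another, both bounded by
    \<open>1\<close>.\<close>
  have slide: "\<bar>S (a + r)\<bar> \<le> 2 * r + \<bar>S a\<bar>" for a r
  proof (induction r)
    case (Suc r)
    have "g (a + r) + S (a + Suc r) = S (a + r) + g (a + r + K * L)"
      using sum.lessThan_Suc[of "\<lambda>i. g (a + r + i)" "K * L"]
        sum.lessThan_Suc_shift[of "\<lambda>i. g (a + r + i)" "K * L"]
      by (simp add: S_def algebra_simps)
    then show ?case using Suc g[of "a + r"] g[of "a + r + K * L"] by simp
  qed simp
  have S_tile: "\<bar>S (t * L)\<bar> \<le> (\<Sum>j<K. \<tau> (t + j))" for t
  proof -
    have "S (t * L) = (\<Sum>j<K. \<Sum>r<L. g ((t + j) * L + r))"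
      unfolding S_def sum_mult_group by (simp add: algebra_simps)
    then show ?thesis unfolding \<tau>_def by (simp add: sum_abs)
  qed
  \<comment> \<open>The shift by \<open>j < K\<close> reaches at most \<open>K\<close> tiles beyond
    the first \<open>T\<close>, each worth at most \<open>L\<close>.\<close>
  have \<tau>_shift: "(\<Sum>t<T. \<tau> (t + j)) \<le> (\<Sum>t<T. \<tau> t) + K * L" if "j < K" for j
  proof -
    have "(\<Sum>t<T. \<tau> (t + j)) = (\<Sum>t\<in>{j..<T + j}. \<tau> t)"
      using sum.shift_bounds_nat_ivl[of \<tau> 0 j T] by (simp add: lessThan_atLeast0)
    also have "\<dots> \<le> (\<Sum>t\<in>{..<T} \<union> {T..<T + K}. \<tau> t)"
      using that by (intro sum_mono2) (auto simp: \<tau>_def)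
    also have "\<dots> = (\<Sum>t<T. \<tau> t) + (\<Sum>t\<in>{T..<T + K}. \<tau> t)"
      by (intro sum.union_disjoint) auto
    also have "(\<Sum>t\<in>{T..<T + K}. \<tau> t) \<le> (\<Sum>t\<in>{T..<T + K}. real L)" by (intro sum_mono \<tau>_le)
    finally show ?thesis by simp
  qed
  have "(\<Sum>p<T * L. \<bar>S p\<bar>) = (\<Sum>t<T. \<Sum>r<L. \<bar>S (t * L + r)\<bar>)" by (rule sum_mult_group)
  also have "\<dots> \<le> (\<Sum>t<T. \<Sum>r<L. 2 * real L + (\<Sum>j<K. \<tau> (t + j)))"
  proof (intro sum_mono)
    fix t r assume "r \<in> {..<L}"
    then show "\<bar>S (t * L + r)\<bar> \<le> 2 * real L + (\<Sum>j<K. \<tau> (t + j))"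
      using slide[of "t * L" r] S_tile[of t] by simp
  qed
  also have "\<dots> = 2 * real L * (real T * L) + L * (\<Sum>t<T. \<Sum>j<K. \<tau> (t + j))"
    by (simp add: sum.distrib sum_distrib_left algebra_simps)
  also have "(\<Sum>t<T. \<Sum>j<K. \<tau> (t + j)) = (\<Sum>j<K. \<Sum>t<T. \<tau> (t + j))" by (rule sum.swap)
  also have "\<dots> \<le> (\<Sum>j<K. (\<Sum>t<T. \<tau> t) + real K * L)"
    using \<tau>_shift by (intro sum_mono) auto
  also have "\<dots> = real K * ((\<Sum>t<T. \<tau> t) + real K * L)" by simp
  finally show ?thesis unfolding S_def \<tau>_def by (simp add: mult_left_mono)
qed

section \<open>Visits in a block and in its complement\<close>

definition visits :: "config set \<Rightarrow> config \<Rightarrow> nat \<Rightarrow> real" where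
  "visits A x p = indicator A ((shift ^^ p) x)"

lemma visits_bounds: "0 \<le> visits A x p" "visits A x p \<le> 1"
  by (auto simp: visits_def indicator_def)

text \<open>The bound \<open>block_len n \<le> q\<close> excludes slot \<open>0\<close>, whose
  filler is not complemented in the second half.\<close>

lemma block_second_half:
  assumes "block_len n \<le> q" "q < 2 ^ n * block_len n"
  shows "block \<beta> (Suc n) (q + 2 ^ n * block_len n) = block \<beta> (Suc n) q + 1"
proof -
  define j r where "j = q div block_len n" and "r = q mod block_len n"
  have j: "1 \<le> j" "j < 2 ^ n" and r: "r < block_len n"
    using assms by (auto simp: j_def r_def div_greater_zero_iff less_mult_imp_div_less Suc_le_eq)
  have q: "q = j * block_len n + r" by (simp add: j_def r_def)
  have "q + 2 ^ n * block_len n = (j + 2 ^ n) * block_len n + r" by (simp add: q algebra_simps)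
  moreover have "1 \<le> j + 2 ^ n" using j by simp
  ultimately show ?thesis
    unfolding q by (simp only: block_Suc_slot[OF j(1) r] block_Suc_slot[OF \<open>1 \<le> j + 2 ^ n\<close> r]
      pattern_add_half[OF j(2)] add.assoc)
qed

text \<open>Changing the sign exchanges the two halves of the block, up to the filler slot and the
  windows that leave their half. Hence both signs give nearly the same count.\<close>

lemma visits_sign_diff:
  assumes A: "determined_by {0..<int w} A"
  shows "\<bar>(\<Sum>r<block_len (Suc n). visits A (block_config \<beta> (Suc n) s) r) -
      (\<Sum>r<block_len (Suc n). visits A (block_config \<beta> (Suc n) (s + 1)) r)\<bar>
    \<le> 2 * (real (block_len n) + real w)"
proof -
  define H where "H = 2 ^ n * block_len n"
  define u where "u s r = visits A (block_config \<beta> (Suc n) s) r" for s r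
  have len: "block_len (Suc n) = H + H" by (simp add: block_len_Suc H_def)
  have split: "(\<Sum>r<H + H. f r) = (\<Sum>r<H. f r + f (r + H))" for f :: "nat \<Rightarrow> real"
  proof -
    have "(\<Sum>r<H + H. f r) = (\<Sum>r<H. f r) + (\<Sum>r\<in>{H..<H + H}. f r)"
      by (subst sum.union_disjoint[symmetric]) (auto intro!: sum.cong)
    also have "(\<Sum>r\<in>{H..<H + H}. f r) = (\<Sum>r<H. f (r + H))"
      using sum.shift_bounds_nat_ivl[of f 0 H H] by (simp add: lessThan_atLeast0)
    finally show ?thesis by (simp add: sum.distrib)
  qed
  have match: "u s (r + H) = u (s + 1) r" if "block_len n \<le> r" "r + w \<le> H" for s r
  proof -
    have "(shift ^^ (r + H)) (block_config \<beta> (Suc n) s) \<in> A \<longleftrightarrow>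
        (shift ^^ r) (block_config \<beta> (Suc n) (s + 1)) \<in> A"
    proof (rule determined_byD[OF A])
      fix i assume i: "i \<in> {0..<int w}"
      define k where "k = nat i"
      have k: "i = int k" "block_len n \<le> k + r" "k + r < 2 ^ n * block_len n"
        using i that by (auto simp: k_def H_def)
      have "block \<beta> (Suc n) (k + (r + H)) + s = block \<beta> (Suc n) (k + r) + (s + 1)"
        using block_second_half[OF k(2,3), of \<beta>]
        by (simp only: H_def add.assoc[symmetric]) (simp only: add_ac)
      then show "(shift ^^ (r + H)) (block_config \<beta> (Suc n) s) i =
          (shift ^^ r) (block_config \<beta> (Suc n) (s + 1)) i"
        unfolding funpow_shift block_config_def k(1) of_nat_add[symmetric] nat_int .
    qed
    then show ?thesis by (simp add: u_def visits_def indicator_def)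
  qed
  have u01: "0 \<le> u s r" "u s r \<le> 1" for s r by (auto simp: u_def visits_bounds)
  have bit2: "s + 1 + 1 = s" by (cases s) auto
  \<comment> \<open>The first half for one sign is paired with the second half for the other; by
    \<open>match\<close> both differences vanish outside the two exceptional ranges.\<close>
  have "(\<Sum>r<H + H. u s r) - (\<Sum>r<H + H. u (s + 1) r) =
      (\<Sum>r<H. (u s r - u (s + 1) (r + H)) + (u s (r + H) - u (s + 1) r))"
    unfolding split by (simp add: sum_subtractf sum.distrib)
  also have "\<bar>\<dots>\<bar> \<le> (\<Sum>r<H. \<bar>(u s r - u (s + 1) (r + H)) + (u s (r + H) - u (s + 1) r)\<bar>)"
    by (rule sum_abs)
  also have "\<dots> \<le> (\<Sum>r<H. if r \<in> {..<block_len n} \<union> {H - w..<H} then 2 else 0)"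
  proof (intro sum_mono)
    fix r assume r: "r \<in> {..<H}"
    show "\<bar>(u s r - u (s + 1) (r + H)) + (u s (r + H) - u (s + 1) r)\<bar>
        \<le> (if r \<in> {..<block_len n} \<union> {H - w..<H} then 2 else 0)"
    proof (cases "r \<in> {..<block_len n} \<union> {H - w..<H}")
      case True
      then show ?thesis using u01[of s r] u01[of "s + 1" "r + H"] u01[of s "r + H"] u01[of "s + 1" r]
        by (simp only: if_True)
    next
      case False
      then have "block_len n \<le> r" "r + w \<le> H" using r by auto
      then show ?thesis using match[of r s] match[of r "s + 1"] False unfolding bit2 by simp
    qed
  qed
  also have "\<dots> = 2 * real (card ({..<H} \<inter> ({..<block_len n} \<union> {H - w..<H})))"
    by (subst sum.inter_restrict[symmetric]) auto
  also have "\<dots> \<le> 2 * real (card ({..<block_len n} \<union> {H - w..<H}))"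
    by (intro mult_left_mono of_nat_mono card_mono) auto
  also have "\<dots> \<le> 2 * real (block_len n + w)"
    using card_Un_le[of "{..<block_len n}" "{H - w..<H}"] by (intro mult_left_mono of_nat_mono) auto
  finally show ?thesis unfolding len u_def by simp
qed

text \<open>The tile has level \<open>Suc n\<close>, so that the cost \<open>2 * block_len n\<close>
  of ignoring its sign is small against \<open>L\<close>. One of the three \<open>w\<close> pays for
  windows that leave the tile, the other two for the change of sign.\<close>

lemma good_tile_sum:
  assumes A: "determined_by {0..<int w} A" and good: "good_tile \<beta> (Suc n) m t"
  defines "L \<equiv> block_len (Suc n)"
  shows "\<bar>(\<Sum>r<L. visits A (block_config \<beta> m 0) (t * L + r)) -
    (\<Sum>r<L. visits A (block_config \<beta> (Suc n) 0) r)\<bar> \<le> 2 * real (block_len n) + 3 * real w"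
proof -
  obtain s where s: "\<And>r. r < L \<Longrightarrow> block \<beta> m (t * L + r) = block \<beta> (Suc n) r + s"
    using good by (auto simp: good_tile_def L_def)
  define u where "u s r = visits A (block_config \<beta> (Suc n) s) r" for s r
  have "\<bar>(\<Sum>r<L. visits A (block_config \<beta> m 0) (t * L + r)) - (\<Sum>r<L. u s r)\<bar>
      \<le> (\<Sum>r<L. \<bar>visits A (block_config \<beta> m 0) (t * L + r) - u s r\<bar>)"
    unfolding sum_subtractf[symmetric] by (rule sum_abs)
  also have "\<dots> \<le> (\<Sum>r<L. if r \<in> {L - w..<L} then 1 else 0)"
  proof (intro sum_mono)
    fix r assume r: "r \<in> {..<L}"
    show "\<bar>visits A (block_config \<beta> m 0) (t * L + r) - u s r\<bar> \<le> (if r \<in> {L - w..<L} then 1 else 0)"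
    proof (cases "r \<in> {L - w..<L}")
      case False
      then have "r + w \<le> L" using r by auto
      then show ?thesis
        using good_tile_visit[of "Suc n" \<beta> m t s w A r] s A False
        by (simp add: u_def visits_def indicator_def L_def)
    qed (auto simp: u_def visits_def indicator_def)
  qed
  also have "\<dots> = real (card ({..<L} \<inter> {L - w..<L}))"
    by (subst sum.inter_restrict[symmetric]) auto
  also have "\<dots> \<le> real (card {L - w..<L})" by (intro of_nat_mono card_mono) auto
  also have "\<dots> \<le> w" by simp
  finally have 1: "\<bar>(\<Sum>r<L. visits A (block_config \<beta> m 0) (t * L + r)) - (\<Sum>r<L. u s r)\<bar> \<le> w" .
  have 2: "\<bar>(\<Sum>r<L. u s r) - (\<Sum>r<L. u 0 r)\<bar> \<le> 2 * (real (block_len n) + real w)"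
    using visits_sign_diff[OF A, where n = n and \<beta> = \<beta> and s = 0] by (cases s) (auto simp: u_def L_def abs_minus_commute)
  have "\<bar>a - c\<bar> \<le> x + y" if "\<bar>a - b\<bar> \<le> x" "\<bar>b - c\<bar> \<le> y" for a b c x y :: real
    using that by linarith
  from this[OF 1 2] show ?thesis by (simp add: u_def)
qed

text \<open>Averages over windows of length \<open>N = K * L\<close> are close in mean to the
  frequency \<open>c\<close> in one block of length \<open>L\<close>. The errors from the tiles,
  from sliding the window and from the end of the block get a third of \<open>\<epsilon>\<close>
  each, by choosing \<open>n\<close>, then \<open>K\<close>, then \<open>m\<close>.\<close>

lemma block_averages:
  fixes \<epsilon> :: real
  assumes A: "determined_by {0..<int w} A" and "0 < \<epsilon>"
  shows "\<exists>N c. 0 < N \<and> (\<forall>\<^sub>F m in sequentially.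
    (\<Sum>p<block_len m. \<bar>(\<Sum>i<N. visits A (block_config \<beta> m 0) (p + i)) / real N - c\<bar>) / block_len m \<le> \<epsilon>)"
proof -
  \<comment> \<open>In the numerator, \<open>3 * real w + 2\<close> will bound the defect of good
    tiles, and the remaining \<open>1\<close> the proportion of bad tiles.\<close>
  obtain n where n: "(3 * real w + 3) / 2 ^ Suc n \<le> \<epsilon> / 3"
  proof -
    obtain n where "3 * (3 * real w + 3) / \<epsilon> < 2 ^ n" using real_arch_pow[of 2 "3 * (3 * real w + 3) / \<epsilon>"] by auto
    then have "(3 * real w + 3) / 2 ^ n \<le> \<epsilon> / 3" using \<open>0 < \<epsilon>\<close> by (simp add: field_simps)
    moreover have "(3 * real w + 3) / 2 ^ Suc n \<le> (3 * real w + 3) / 2 ^ n"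
      by (intro divide_left_mono) auto
    ultimately have "(3 * real w + 3) / 2 ^ Suc n \<le> \<epsilon> / 3" by (rule order_trans[rotated])
    then show ?thesis by (rule that)
  qed
  define L where "L = block_len (Suc n)"
  have Lpos: "0 < L" by (simp add: L_def)
  define c where "c = (\<Sum>r<L. visits A (block_config \<beta> (Suc n) 0) r) / L"
  \<comment> \<open>This choice brings the sliding error \<open>2 / K\<close> below
    \<open>\<epsilon> / 3\<close>.\<close>
  obtain K :: nat where K: "6 / \<epsilon> < K" using reals_Archimedean2 by blast
  then have Kpos: "0 < K"
    using \<open>0 < \<epsilon>\<close> by (auto simp: field_simps intro: Nat.gr0I)
  with K have K': "2 / K \<le> \<epsilon> / 3"
    using \<open>0 < \<epsilon>\<close> by (simp add: field_simps)
  have c01: "0 \<le> c" "c \<le> 1"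
  proof -
    have "(\<Sum>r<L. visits A (block_config \<beta> (Suc n) 0) r) \<le> (\<Sum>r<L. 1)" by (intro sum_mono visits_bounds)
    then show "c \<le> 1" using Lpos by (simp add: c_def)
    show "0 \<le> c" unfolding c_def by (intro divide_nonneg_nonneg sum_nonneg visits_bounds) auto
  qed
  \<comment> \<open>With at least \<open>3 * K / \<epsilon>\<close> tiles in the block, the error
    \<open>K / T\<close> at its end is at most \<open>\<epsilon> / 3\<close>.\<close>
  have "\<forall>\<^sub>F m in sequentially. Suc n \<le> m \<and> L * nat \<lceil>3 * K / \<epsilon>\<rceil> \<le> block_len m"
    using block_len_tendsto by (intro eventually_conj eventually_ge_at_top) (auto simp: filterlim_at_top)
  then have "\<forall>\<^sub>F m in sequentially.
    (\<Sum>p<block_len m. \<bar>(\<Sum>i<K * L. visits A (block_config \<beta> m 0) (p + i)) / real (K * L) - c\<bar>) / block_len m \<le> \<epsilon>"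
  proof eventually_elim
    case (elim m)
    define T where "T = block_len m div L"
    have len: "block_len m = T * L" using block_len_mono_dvd[of "Suc n" m] elim by (simp add: T_def L_def)
    have Tpos: "0 < T" using len block_len_pos[of m] by (cases T) auto
    have "nat \<lceil>3 * K / \<epsilon>\<rceil> \<le> T" using elim Lpos by (simp add: len mult.commute)
    then have "3 * K / \<epsilon> \<le> T" by linarith
    then have KT: "K / T \<le> \<epsilon> / 3" using Tpos \<open>0 < \<epsilon>\<close> by (simp add: field_simps)
    define g where "g p = visits A (block_config \<beta> m 0) p - c" for p
    have g1: "\<bar>g i\<bar> \<le> 1" for i
      using c01 visits_bounds[of A "block_config \<beta> m 0" i] by (auto simp: g_def)
    define \<tau> where "\<tau> t = \<bar>\<Sum>r<L. g (t * L + r)\<bar>" for t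
    define \<kappa> where "\<kappa> = 2 * real (block_len n) + 3 * real w"
    have \<tau>: "\<tau> t \<le> \<kappa> + (if \<not> good_tile \<beta> (Suc n) m t then real L else 0)" for t
    proof (cases "good_tile \<beta> (Suc n) m t")
      case True
      have "(\<Sum>r<L. g (t * L + r)) = (\<Sum>r<L. visits A (block_config \<beta> m 0) (t * L + r)) - L * c"
        by (simp add: g_def sum_subtractf)
      also have "L * c = (\<Sum>r<L. visits A (block_config \<beta> (Suc n) 0) r)" using Lpos by (simp add: c_def)
      finally show ?thesis
        using good_tile_sum[OF A True] True by (simp add: \<tau>_def \<kappa>_def L_def)
    next
      case False
      have "\<tau> t \<le> (\<Sum>r<L. \<bar>g (t * L + r)\<bar>)" unfolding \<tau>_def by (rule sum_abs)
      also have "\<dots> \<le> (\<Sum>r<L. 1)" by (intro sum_mono g1)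
      finally show ?thesis using False by (simp add: \<kappa>_def)
    qed
    have "(\<Sum>t<T. \<tau> t) \<le> (\<Sum>t<T. \<kappa> + (if \<not> good_tile \<beta> (Suc n) m t then real L else 0))"
      by (intro sum_mono \<tau>)
    also have "\<dots> = T * \<kappa> + real L * real (card {t. t < T \<and> \<not> good_tile \<beta> (Suc n) m t})"
      by (simp add: sum.distrib sum.If_cases Int_def conj_commute)
    also have "\<dots> \<le> T * \<kappa> + real L * (real T / 2 ^ Suc n)"
      using elim by (intro add_left_mono mult_left_mono
          card_bad_tiles_le[of "Suc n" m \<beta>, folded L_def, folded T_def]) auto
    finally have tiles: "(\<Sum>t<T. \<tau> t) \<le> T * (\<kappa> + L / 2 ^ Suc n)" by (simp add: algebra_simps)
    have avg: "\<bar>(\<Sum>i<K * L. visits A (block_config \<beta> m 0) (p + i)) / real (K * L) - c\<bar>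
        = \<bar>\<Sum>i<K * L. g (p + i)\<bar> / (K * L)" for p
    proof -
      have "(\<Sum>i<K * L. visits A (block_config \<beta> m 0) (p + i)) / real (K * L) - c
          = (\<Sum>i<K * L. g (p + i)) / (K * L)"
        using Kpos Lpos by (simp add: g_def sum_subtractf diff_divide_distrib)
      then show ?thesis by (simp add: abs_divide)
    qed
    have "(\<Sum>p<block_len m. \<bar>\<Sum>i<K * L. g (p + i)\<bar>)
        \<le> 2 * real L * (real T * L) + L * (real K * ((\<Sum>t<T. \<tau> t) + real K * L))"
      unfolding len \<tau>_def by (rule window_sum_bound[OF g1])
    also have "\<dots> \<le> 2 * real L * (real T * L) + L * (real K * (T * (\<kappa> + L / 2 ^ Suc n) + real K * L))"
      using tiles by (intro add_left_mono mult_left_mono add_right_mono) auto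
    finally have main: "(\<Sum>p<block_len m. \<bar>\<Sum>i<K * L. g (p + i)\<bar>) / (K * L) / block_len m
        \<le> (2 * real L * (real T * L) + L * (real K * (T * (\<kappa> + L / 2 ^ Suc n) + real K * L))) / (K * L) / (T * L)"
      unfolding len by (intro divide_right_mono) auto
    also have "\<dots> = 2 / K + (\<kappa> / L + 1 / 2 ^ Suc n) + K / T"
      using Kpos Lpos Tpos by (simp add: field_simps)
    also have "\<kappa> / L + 1 / 2 ^ Suc n \<le> (3 * real w + 3) / 2 ^ Suc n"
    proof -
      have "2 * real (block_len n) / L = 2 / 2 ^ Suc n" by (simp add: L_def block_len_Suc)
      moreover have "3 * real w / L \<le> 3 * real w / 2 ^ Suc n"
        using power_le_block_len[of "Suc n"] of_nat_mono[OF power_le_block_len[of "Suc n"], where 'a = real]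
        by (intro divide_left_mono) (auto simp: L_def)
      ultimately show ?thesis unfolding \<kappa>_def by (simp add: add_divide_distrib)
    qed
    finally show ?case using n K' KT unfolding avg sum_divide_distrib[symmetric] by linarith
  qed
  then show ?thesis using Kpos Lpos by (intro exI[of _ "K * L"] exI[of _ c]) auto
qed

section \<open>Visits forced by the pattern and by the filler\<close>

text \<open>Frobenius in characteristic 2: \<open>xor_ca\<close> is the identity plus the shift, and
  in each squaring the cross terms cancel.\<close>

lemma xor_ca_funpow_two_power: "(xor_ca ^^ (2 ^ k)) x = (\<lambda>i. x i + x (i + 2 ^ k))"
proof (induction k arbitrary: x)
  case 0
  then show ?case by (simp add: xor_ca_def)
next
  case (Suc k)
  have "(xor_ca ^^ (2 ^ Suc k)) x = (xor_ca ^^ (2 ^ k)) ((xor_ca ^^ (2 ^ k)) x)"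
    by (simp add: mult_2 funpow_add)
  also have "\<dots> = (\<lambda>i. (x i + x (i + 2 ^ k)) + (x (i + 2 ^ k) + x (i + 2 ^ Suc k)))"
    by (simp add: Suc add.assoc)
  also have "\<dots> = (\<lambda>i. x i + x (i + 2 ^ Suc k))"
    by (simp only: add.assoc bit_add_self_left)
  finally show ?case .
qed

lemma xor_ca_funpow_block_len: "(xor_ca ^^ block_len n) x = (\<lambda>i. x i + x (i + int (block_len n)))"
  by (simp add: block_len_def xor_ca_funpow_two_power)

lemma determined_by_xor_ca_funpow:
  assumes "determined_by {0..<int k} A"
  shows "determined_by {0..<int (k + block_len n)} ((xor_ca ^^ block_len n) -` A)"
  unfolding determined_by_def
proof (intro allI impI)
  fix x y assume eq: "\<forall>i\<in>{0..<int (k + block_len n)}. x i = y i"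
    and x: "x \<in> (xor_ca ^^ block_len n) -` A"
  have "(xor_ca ^^ block_len n) x \<in> A \<longleftrightarrow> (xor_ca ^^ block_len n) y \<in> A"
  proof (rule determined_byD[OF assms])
    fix i assume "i \<in> {0..<int k}"
    then have "x i = y i" "x (i + int (block_len n)) = y (i + int (block_len n))" using eq by auto
    then show "(xor_ca ^^ block_len n) x i = (xor_ca ^^ block_len n) y i"
      by (simp only: xor_ca_funpow_block_len)
  qed
  with x show "y \<in> (xor_ca ^^ block_len n) -` A" by simp
qed

text \<open>Since \<open>0 \<le> \<beta> \<le> 1\<close>, the floor grows by \<open>0\<close> or
  \<open>1\<close> at each step, so the number of jumps telescopes.\<close>

lemma card_floor_jumps:
  fixes \<beta> :: real
  assumes "0 \<le> \<beta>" "\<beta> \<le> 1"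
  shows "int (card {j. j < M \<and> \<lfloor>\<beta> * real (Suc j)\<rfloor> \<noteq> \<lfloor>\<beta> * real j\<rfloor>}) = \<lfloor>\<beta> * real M\<rfloor>"
proof (induction M)
  case (Suc M)
  let ?J = "\<lambda>M. {j. j < M \<and> \<lfloor>\<beta> * real (Suc j)\<rfloor> \<noteq> \<lfloor>\<beta> * real j\<rfloor>}"
  have "?J (Suc M) = (if \<lfloor>\<beta> * real (Suc M)\<rfloor> \<noteq> \<lfloor>\<beta> * real M\<rfloor> then insert M (?J M) else ?J M)"
    by (auto simp: less_Suc_eq)
  moreover have "\<beta> * real M \<le> \<beta> * real (Suc M)" "\<beta> * real (Suc M) \<le> \<beta> * real M + 1"
    using assms by (auto simp: algebra_simps)
  then have "\<lfloor>\<beta> * real M\<rfloor> \<le> \<lfloor>\<beta> * real (Suc M)\<rfloor>" "\<lfloor>\<beta> * real (Suc M)\<rfloor> \<le> \<lfloor>\<beta> * real M\<rfloor> + 1"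
    by linarith+
  ultimately show ?case using Suc by (auto simp: split: if_splits)
qed simp

text \<open>A jump by one flips the parity of the floor; \<open>Suc j < 2 ^ n\<close> keeps both
  positions in the first half.\<close>

lemma pattern_step:
  fixes \<beta> :: real
  assumes "0 \<le> \<beta>" "\<beta> \<le> 1" "Suc j < 2 ^ n"
  shows "pattern \<beta> n j + pattern \<beta> n (Suc j) = of_bool (\<lfloor>\<beta> * real (Suc j)\<rfloor> \<noteq> \<lfloor>\<beta> * real j\<rfloor>)"
proof -
  have "\<beta> * real j \<le> \<beta> * real (Suc j)" "\<beta> * real (Suc j) \<le> \<beta> * real j + 1"
    using assms by (auto simp: algebra_simps)
  then have "\<lfloor>\<beta> * real (Suc j)\<rfloor> = \<lfloor>\<beta> * real j\<rfloor> \<or> \<lfloor>\<beta> * real (Suc j)\<rfloor> = \<lfloor>\<beta> * real j\<rfloor> + 1"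
    by linarith
  then show ?thesis using assms(3) by (auto simp: pattern_def)
qed

text \<open>Each half has \<open>2 ^ n - 1\<close> adjacent pairs, and complementing a half
  preserves their sums. The loss \<open>5\<close> collects a rounding error of \<open>1\<close> in
  each half, the excluded \<open>j = 0\<close>, and at most \<open>2\<close> for having
  \<open>2 ^ n - 1\<close> pairs in place of \<open>2 ^ n\<close>.\<close>

lemma card_pattern_steps_ge:
  fixes \<beta> :: real and a :: bit
  assumes \<beta>: "0 \<le> \<beta>" "\<beta> \<le> 1"
  shows "2 ^ Suc n * (if a = 1 then \<beta> else 1 - \<beta>) - 5 \<le>
    real (card {j. 1 \<le> j \<and> Suc j < 2 ^ Suc n \<and> pattern \<beta> n j + pattern \<beta> n (Suc j) = a})"
proof -
  define \<gamma> where "\<gamma> = (if a = 1 then \<beta> else 1 - \<beta>)"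
  define M :: nat where "M = 2 ^ n - 1"
  have M: "j < M \<longleftrightarrow> Suc j < 2 ^ n" for j by (auto simp: M_def)
  have realM: "real M = 2 ^ n - 1" by (simp add: M_def of_nat_diff)
  define P where "P j \<longleftrightarrow> pattern \<beta> n j + pattern \<beta> n (Suc j) = a" for j
  define D where "D = {j. j < M \<and> P j}"
  define Q where "Q = {j. 1 \<le> j \<and> Suc j < 2 ^ Suc n \<and> P j}"
  have finD: "finite D" by (auto simp: D_def)
  have lower: "\<gamma> * M - 1 \<le> card D"
  proof -
    let ?J = "{j. j < M \<and> \<lfloor>\<beta> * real (Suc j)\<rfloor> \<noteq> \<lfloor>\<beta> * real j\<rfloor>}"
    have J: "real (card ?J) = \<lfloor>\<beta> * real M\<rfloor>"
      using arg_cong[OF card_floor_jumps[OF \<beta>, of M], of real_of_int] by (simp only: of_int_of_nat_eq)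
    have P: "P j \<longleftrightarrow> a = of_bool (\<lfloor>\<beta> * real (Suc j)\<rfloor> \<noteq> \<lfloor>\<beta> * real j\<rfloor>)" if "j < M" for j
      using pattern_step[OF \<beta> iffD1[OF M that]] unfolding P_def by (simp only: eq_commute[of a])
    show ?thesis
    proof (cases a)
      case zero
      have "D = {..<M} - ?J" using P zero by (auto simp: D_def simp del: of_nat_Suc)
      then have "card D = M - card ?J" by (simp add: card_Diff_subset subset_eq)
      moreover have "card ?J \<le> card {..<M}" by (rule card_mono) auto
      ultimately have "real (card D) = M - real_of_int \<lfloor>\<beta> * real M\<rfloor>" using J by (simp add: of_nat_diff)
      also have "\<dots> \<ge> M - \<beta> * M" by linarith
      finally show ?thesis by (simp add: \<gamma>_def zero algebra_simps)
    next
      case one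
      have "D = ?J" using P one by (auto simp: D_def simp del: of_nat_Suc)
      then have "real (card D) = real_of_int \<lfloor>\<beta> * real M\<rfloor>" using J by simp
      also have "\<dots> \<ge> \<beta> * M - 1" by linarith
      finally show ?thesis by (simp add: \<gamma>_def one)
    qed
  qed
  \<comment> \<open>The \<open>Suc\<close> is for \<open>j = 0\<close>, which may lie in
    \<open>D\<close> but never in \<open>Q\<close>.\<close>
  have "2 * card D \<le> Suc (card Q)"
  proof -
    have P_half: "P (j + 2 ^ n)" if "j < M" "P j" for j
    proof -
      have "Suc j < 2 ^ n" using that M by simp
      then have "pattern \<beta> n (j + 2 ^ n) = pattern \<beta> n j + 1"
          "pattern \<beta> n (Suc j + 2 ^ n) = pattern \<beta> n (Suc j) + 1"
        by (intro pattern_add_half; simp)+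
      then show ?thesis using that(2) unfolding P_def
        by (cases "pattern \<beta> n j"; cases "pattern \<beta> n (Suc j)") auto
    qed
    have "D \<union> (\<lambda>j. j + 2 ^ n) ` D \<subseteq> insert 0 Q"
      using P_half by (auto simp: D_def Q_def M)
    then have "card (D \<union> (\<lambda>j. j + 2 ^ n) ` D) \<le> card (insert 0 Q)"
      by (rule card_mono[rotated]) (auto simp: Q_def intro: finite_subset[of _ "{..<2 ^ Suc n}"])
    also have "\<dots> \<le> Suc (card Q)"
      by (intro card_insert_le_m1) (auto simp: Q_def)
    also have "card (D \<union> (\<lambda>j. j + 2 ^ n) ` D) = card D + card ((\<lambda>j. j + 2 ^ n) ` D)"
      using finD by (intro card_Un_disjoint) (auto simp: D_def M)
    also have "card ((\<lambda>j. j + 2 ^ n) ` D) = card D" by (simp add: card_image)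
    finally show ?thesis by simp
  qed
  then have "2 * real (card D) \<le> 1 + real (card Q)" by linarith
  with lower have "2 * (\<gamma> * real M - 1) - 1 \<le> card Q"
    by argo
  moreover have "\<gamma> \<le> 1" using \<beta> by (auto simp: \<gamma>_def)
  ultimately show ?thesis unfolding realM Q_def P_def \<gamma>_def[symmetric] by (simp add: algebra_simps)
qed

text \<open>Where neighbouring slots have pattern sum \<open>a\<close>, a symbol and its translate
  by \<open>block_len n\<close> add up to \<open>a\<close>, so the iterate of \<open>xor_ca\<close>
  shows a run of \<open>a\<close>. In each such slot, \<open>block_len n - k\<close> starting
  positions keep the word of length \<open>k\<close> inside the slot.\<close>

lemma visit_freq_xor_const:
  fixes \<beta> :: real
  assumes \<beta>: "0 \<le> \<beta>" "\<beta> \<le> 1" and k: "k \<le> block_len n" and m: "Suc n \<le> m"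
  shows "(1 - 1 / 2 ^ Suc n) * (((if a = 1 then \<beta> else 1 - \<beta>) - 5 / 2 ^ Suc n) * (1 - real k / block_len n))
    \<le> visit_freq (block_len m) (block_config \<beta> m 0)
        ((xor_ca ^^ block_len n) -` cylinder (replicate k a))"
proof -
  define L where "L = block_len n"
  define J where "J = {j. 1 \<le> j \<and> Suc j < 2 ^ Suc n \<and> pattern \<beta> n j + pattern \<beta> n (Suc j) = a}"
  define A where "A = (xor_ca ^^ L) -` cylinder (replicate k a)"
  have Lpos: "0 < L" by (simp add: L_def)
  have len: "block_len (Suc n) = 2 ^ Suc n * L" by (simp only: block_len_Suc L_def)
  have A: "determined_by {0..<int (k + L)} A"
    using determined_by_xor_ca_funpow[OF determined_by_cylinder] unfolding A_def L_def
    by (metis length_replicate)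
  have finJ: "finite J" by (rule finite_subset[of _ "{..<2 ^ Suc n}"]) (auto simp: J_def)
  have visit: "j * L + r + (k + L) \<le> block_len (Suc n)"
      "(shift ^^ (j * L + r)) (block_config \<beta> (Suc n) s) \<in> A"
    if j: "j \<in> J" and r: "r < L - k" for j r s
  proof -
    have "j * L + r + (k + L) \<le> (j + 2) * L" using r by simp
    also have "\<dots> \<le> 2 ^ Suc n * L" using j by (intro mult_right_mono) (auto simp: J_def)
    finally show "j * L + r + (k + L) \<le> block_len (Suc n)" by (simp only: len)
    have "block \<beta> (Suc n) (j * L + r + i) + s + (block \<beta> (Suc n) (j * L + r + i + L) + s) = a"
      if "i < k" for i
    proof -
      have ri: "r + i < L" using r that by simp
      have "block \<beta> (Suc n) (j * L + r + i) = block \<beta> n (r + i) + pattern \<beta> n j"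
        using block_Suc_slot[of j "r + i" n \<beta>] j ri
        by (simp only: L_def J_def mem_Collect_eq add.assoc)
      moreover have "block \<beta> (Suc n) (j * L + r + i + L) = block \<beta> n (r + i) + pattern \<beta> n (Suc j)"
      proof -
        have "j * L + r + i + L = Suc j * L + (r + i)" by simp
        then show ?thesis using block_Suc_slot[of "Suc j" "r + i" n \<beta>] ri
          by (simp only: L_def le_add1 plus_1_eq_Suc[symmetric])
      qed
      moreover have "pattern \<beta> n j + pattern \<beta> n (Suc j) = a" using j by (simp add: J_def)
      \<comment> \<open>The block value \<open>u\<close> and the sign \<open>s\<close> occur twice
        and cancel, so the visits are the same for both signs, as \<open>visit_freq_block_ge\<close>
        demands.\<close>
      moreover have "(u + x) + s + ((u + y) + s) = x + y" for u x y :: bit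
        by (cases u; cases x; cases y; cases s) simp_all
      ultimately show ?thesis by simp
    qed
    then show "(shift ^^ (j * L + r)) (block_config \<beta> (Suc n) s) \<in> A"
      unfolding A_def L_def vimage_eq xor_ca_funpow_block_len cylinder_def funpow_shift block_config_def
        length_replicate mem_Collect_eq
      by (simp flip: of_nat_add of_nat_mult add: nat_int add_ac)
  qed
  have "card J * (L - k) \<le> card {r. r + (k + L) \<le> block_len (Suc n) \<and> r < block_len (Suc n) \<and>
      (shift ^^ r) (block_config \<beta> (Suc n) s) \<in> A}" for s
  proof -
    have "card J * (L - k) = card (J \<times> {..<L - k})" by (simp add: card_cartesian_product)
    also have "\<dots> = card ((\<lambda>(j, r). j * L + r) ` (J \<times> {..<L - k}))"
    proof (rule card_image[symmetric], rule inj_onI, clarsimp)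
      fix j r j' r' assume "r < L - k" "r' < L - k" and eq: "j * L + r = j' * L + r'"
      then have "r < L" "r' < L" by auto
      then show "j = j' \<and> r = r'"
        using arg_cong[OF eq, of "\<lambda>x. x div L"] arg_cong[OF eq, of "\<lambda>x. x mod L"] by simp
    qed
    also have "\<dots> \<le> card {r. r + (k + L) \<le> block_len (Suc n) \<and> r < block_len (Suc n) \<and>
      (shift ^^ r) (block_config \<beta> (Suc n) s) \<in> A}"
      using visit Lpos by (intro card_mono) fastforce+
    finally show ?thesis .
  qed
  from visit_freq_block_ge[OF m A this]
  have "(1 - 1 / 2 ^ Suc n) * (real (card J * (L - k)) / real (block_len (Suc n)))
    \<le> visit_freq (block_len m) (block_config \<beta> m 0) A" .
  moreover have "((if a = 1 then \<beta> else 1 - \<beta>) - 5 / 2 ^ Suc n) * (1 - real k / L)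
      \<le> real (card J * (L - k)) / real (block_len (Suc n))"
  proof -
    define \<gamma> where "\<gamma> = (if a = 1 then \<beta> else 1 - \<beta>)"
    have "(2 ^ Suc n * \<gamma> - 5) * (real L - k) \<le> card J * (real L - k)"
      using card_pattern_steps_ge[OF \<beta>, of n a] k
      by (intro mult_right_mono) (auto simp: J_def L_def \<gamma>_def)
    also have "\<dots> = real (card J * (L - k))" using k by (simp add: L_def of_nat_diff)
    finally have "(2 ^ Suc n * \<gamma> - 5) * (real L - k) / (2 ^ Suc n * L) \<le> real (card J * (L - k)) / (2 ^ Suc n * L)"
      by (intro divide_right_mono) auto
    moreover have "(\<gamma> - 5 / 2 ^ Suc n) * (1 - real k / L) = (2 ^ Suc n * \<gamma> - 5) * (real L - k) / (2 ^ Suc n * L)"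
      using Lpos by (simp add: field_simps)
    ultimately show ?thesis by (simp add: \<gamma>_def len)
  qed
  then have "(1 - 1 / 2 ^ Suc n) * (((if a = 1 then \<beta> else 1 - \<beta>) - 5 / 2 ^ Suc n) * (1 - real k / L))
      \<le> (1 - 1 / 2 ^ Suc n) * (real (card J * (L - k)) / real (block_len (Suc n)))"
    using one_le_power[of "2 :: real" "Suc n"] by (intro mult_left_mono) simp_all
  ultimately show ?thesis unfolding A_def L_def by linarith
qed

text \<open>The filler puts \<open>u\<close> at the start of some block, and the next level contains
  this block with either sign. \<open>n > 0\<close> makes the factor \<open>1 - 1 / 2 ^ n\<close> in
  \<open>visit_freq_block_ge\<close> positive.\<close>

lemma block_contains_word:
  "\<exists>n>0. \<forall>s. \<exists>r. r + length u \<le> block_len n \<and> r < block_len n \<and>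
    (shift ^^ r) (block_config \<beta> n s) \<in> cylinder u"
proof -
  define w where "w = map (\<lambda>b. b = (1 :: bit)) u"
  have "infinite (range (\<lambda>i :: nat. to_nat (w, i)))"
    by (rule range_inj_infinite) (auto intro: injI)
  then obtain k' where "length u \<le> k'" "k' \<in> range (\<lambda>i :: nat. to_nat (w, i))"
    unfolding infinite_nat_iff_unbounded_le by blast
  then obtain i :: nat where i: "length u \<le> to_nat (w, i)" by blast
  define k where "k = to_nat (w, i)"
  define L where "L = block_len (Suc k)"
  have k: "length u \<le> block_len k" using i less_block_len[of k] by (simp add: k_def)
  also have "\<dots> \<le> L" by (simp add: L_def block_len_Suc)
  finally have uL: "length u \<le> L" .
  have Lpos: "0 < L" by (simp add: L_def)
  have word: "block \<beta> (Suc k) p = u ! p" if "p < length u" for p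
    using that k by (cases "u ! p") (auto simp: filler_def k_def w_def)
  have "\<exists>r. r + length u \<le> block_len (Suc (Suc k)) \<and> r < block_len (Suc (Suc k)) \<and>
    (shift ^^ r) (block_config \<beta> (Suc (Suc k)) s) \<in> cylinder u" for s
  proof -
    \<comment> \<open>Slots \<open>1\<close> and \<open>1 + 2 ^ Suc k\<close> have opposite pattern
      values, so one of them has the value \<open>s\<close> and cancels the sign.\<close>
    have "pattern \<beta> (Suc k) (1 + 2 ^ Suc k) = pattern \<beta> (Suc k) 1 + 1"
      by (intro pattern_add_half one_less_power) simp_all
    then obtain j where j: "j \<in> {1, 1 + 2 ^ Suc k}" "pattern \<beta> (Suc k) j = s"
      by (cases s; cases "pattern \<beta> (Suc k) 1") auto
    have "1 < (2 :: nat) ^ Suc k" by (rule one_less_power) simp_all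
    then have j2: "1 \<le> j" "Suc j \<le> 2 ^ Suc (Suc k)" using j(1) by auto
    have "j * L + L = Suc j * L" by simp
    also have "\<dots> \<le> 2 ^ Suc (Suc k) * L" by (intro mult_right_mono j2) simp
    finally have "j * L + L \<le> block_len (Suc (Suc k))" by (simp only: block_len_Suc[of "Suc k"] L_def)
    moreover have "(shift ^^ (j * L)) (block_config \<beta> (Suc (Suc k)) s) \<in> cylinder u"
    proof -
      have "block \<beta> (Suc (Suc k)) (j * L + i) + s = u ! i" if "i < length u" for i
      proof -
        have "i < block_len (Suc k)" using that uL by (simp add: L_def)
        from block_Suc_slot[OF j2(1) this, of \<beta>] word[OF that] j(2)
        have "block \<beta> (Suc (Suc k)) (j * L + i) = u ! i + s" by (simp only: L_def)
        then show ?thesis by (simp only: add.assoc bit_add_self add_0_right)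
      qed
      then show ?thesis
        unfolding cylinder_def funpow_shift block_config_def mem_Collect_eq
        by (simp flip: of_nat_add of_nat_mult add: nat_int add_ac del: block.simps)
    qed
    ultimately show ?thesis using uL Lpos by (intro exI[of _ "j * L"]) auto
  qed
  then show ?thesis by (intro exI[of _ "Suc (Suc k)"]) auto
qed

section \<open>Ergodicity and convergence\<close>

locale stationary = prob_space \<mu> for \<mu> :: "config measure" +
  assumes sets_eq: "sets \<mu> = sets configs"
    and invariant: "distr \<mu> configs shift = \<mu>"
begin

lemma space_eq: "space \<mu> = UNIV"
  using sets_eq_imp_space_eq[OF sets_eq] by simp

lemma measurable_shift_funpow: "(shift ^^ i) \<in> measurable configs configs"
proof (induction i)
  case (Suc i)
  show ?case unfolding funpow.simps by (rule measurable_comp[OF Suc measurable_shift])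
qed (simp add: id_def)

lemma vimage_shift_funpow: "B \<in> sets configs \<Longrightarrow> (shift ^^ i) -` B \<in> sets configs"
  using measurable_sets[OF measurable_shift_funpow, of B i] by simp

lemma prob_shift: "B \<in> sets configs \<Longrightarrow> prob (shift -` B) = prob B"
  using measure_distr[of shift \<mu> configs B] measurable_shift invariant
    measurable_cong_sets[OF sets_eq refl, of configs] by (simp add: space_eq)

lemma prob_shift_funpow: "B \<in> sets configs \<Longrightarrow> prob ((shift ^^ i) -` B) = prob B"
proof (induction i)
  case (Suc i)
  have "(shift ^^ Suc i) -` B = shift -` ((shift ^^ i) -` B)"
    by (simp only: funpow_Suc_right vimage_comp)
  then have "prob ((shift ^^ Suc i) -` B) = prob ((shift ^^ i) -` B)"
    using prob_shift[OF vimage_shift_funpow[OF Suc.prems]] by (simp only:)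
  then show ?case using Suc.IH[OF Suc.prems] by (simp only:)
qed simp

lemma vimage_shift_funpow_invariant: "shift -` A = A \<Longrightarrow> (shift ^^ i) -` A = A"
  by (induction i) (simp_all add: vimage_comp[symmetric] funpow_Suc_right del: funpow.simps(2))

text \<open>By invariance, all preimages of \<open>C\<close> under powers of \<open>shift\<close>
  meet \<open>A\<close> with the same probability, so integrating the average over \<open>A\<close>
  returns \<open>prob (A \<inter> C)\<close>. The case \<open>A = UNIV\<close> compares
  \<open>prob C\<close> with \<open>c\<close>.\<close>

lemma invariant_Int_average:
  assumes A: "A \<in> sets configs" "shift -` A = A" and C: "C \<in> sets configs" and "0 < N"
  shows "\<bar>prob (A \<inter> C) - c * prob A\<bar> \<le> (\<integral>x. \<bar>(\<Sum>i<N. visits C x i) / real N - c\<bar> \<partial>\<mu>)"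
proof -
  define f where "f x = (\<Sum>i<N. visits C x i) / real N - c" for x
  have ind: "integrable \<mu> (indicator B :: config \<Rightarrow> real)" if "B \<in> sets configs" for B
    using that by (intro integrable_real_indicator) (auto simp: sets_eq emeasure_eq_measure)
  have vis: "(\<lambda>x. visits C x i) = indicator ((shift ^^ i) -` C)" for i
    by (auto simp: visits_def indicator_def)
  have visA: "indicator A x * visits C x i = indicator (A \<inter> (shift ^^ i) -` C) x" for x i
    by (auto simp: visits_def indicator_def)
  have int_vis: "integrable \<mu> (\<lambda>x. visits C x i)" for i
    unfolding vis using C by (intro ind vimage_shift_funpow)
  have int_visA: "integrable \<mu> (\<lambda>x. indicator A x * visits C x i)" for i
    unfolding visA using A C by (intro ind sets.Int vimage_shift_funpow)
  have int_f: "integrable \<mu> f" unfolding f_def using int_vis by (intro Bochner_Integration.integrable_diff integrable_divide_zero Bochner_Integration.integrable_sum) auto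
  have "(\<integral>x. indicator A x * visits C x i \<partial>\<mu>) = prob (A \<inter> C)" for i
  proof -
    have "A \<inter> (shift ^^ i) -` C = (shift ^^ i) -` (A \<inter> C)"
      using vimage_shift_funpow_invariant[OF A(2)] by simp
    then show ?thesis
      unfolding visA using prob_shift_funpow[of "A \<inter> C" i] A C by (simp add: space_eq)
  qed
  then have avg: "(\<integral>x. (\<Sum>i<N. indicator A x * visits C x i) \<partial>\<mu>) = N * prob (A \<inter> C)"
    using int_visA by (subst Bochner_Integration.integral_sum) auto
  have fA: "indicator A x * f x = (\<Sum>i<N. indicator A x * visits C x i) / N - c * indicator A x" for x
    by (simp add: f_def right_diff_distrib sum_distrib_left[symmetric])
  have int_fA: "integrable \<mu> (\<lambda>x. indicator A x * f x)"
    unfolding fA using int_visA ind A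
    by (intro Bochner_Integration.integrable_diff integrable_divide_zero Bochner_Integration.integrable_sum integrable_mult_right) auto
  have "(\<integral>x. indicator A x * f x \<partial>\<mu>) = (\<integral>x. (\<Sum>i<N. indicator A x * visits C x i) / N \<partial>\<mu>) - (\<integral>x. c * indicator A x \<partial>\<mu>)"
    unfolding fA using int_visA ind A
    by (intro Bochner_Integration.integral_diff integrable_divide_zero Bochner_Integration.integrable_sum integrable_mult_right) auto
  also have "\<dots> = prob (A \<inter> C) - c * prob A"
    using avg \<open>0 < N\<close> by (simp add: space_eq)
  finally have "\<bar>prob (A \<inter> C) - c * prob A\<bar> = \<bar>\<integral>x. indicator A x * f x \<partial>\<mu>\<bar>" by simp
  also have "\<dots> \<le> (\<integral>x. \<bar>indicator A x * f x\<bar> \<partial>\<mu>)" by (rule integral_abs_bound)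
  also have "\<dots> \<le> (\<integral>x. \<bar>f x\<bar> \<partial>\<mu>)"
    using int_f int_fA by (intro integral_mono integrable_abs) (auto simp: indicator_def)
  finally show ?thesis by (simp add: f_def)
qed

text \<open>An invariant set correlates with \<open>C\<close> as it does with the averages of \<open>C\<close>; if these are almost
  constant, the set is independent of every local set, hence of itself.\<close>

lemma ergodic_of_averages:
  assumes avg: "\<And>C w \<epsilon>. determined_by {0..<int w} C \<Longrightarrow> 0 < \<epsilon> \<Longrightarrow>
    \<exists>N c. 0 < N \<and> (\<integral>x. \<bar>(\<Sum>i<N. visits C x i) / real N - c\<bar> \<partial>\<mu>) \<le> \<epsilon>"
  shows "shift_ergodic \<mu>"
  unfolding shift_ergodic_def
proof (intro ballI impI)
  fix A assume "A \<in> sets \<mu>" and inv: "shift -` A = A"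
  then have A: "A \<in> sets configs" by (simp add: sets_eq)
  have fwd: "prob (A \<inter> C) = prob A * prob C" if C: "determined_by {0..<int w} C" for C w
  proof -
    have mC: "C \<in> sets configs"
      by (rule local_sets_measurable) (use C in \<open>auto simp: local_sets_def\<close>)
    \<comment> \<open>The form \<open>0 + \<epsilon>\<close> is the one that
      \<open>field_le_epsilon\<close> expects.\<close>
    have "\<bar>prob (A \<inter> C) - prob A * prob C\<bar> \<le> 0 + \<epsilon>" if "0 < \<epsilon>" for \<epsilon>
    proof -
      obtain N c where N: "0 < N" "(\<integral>x. \<bar>(\<Sum>i<N. visits C x i) / real N - c\<bar> \<partial>\<mu>) \<le> \<epsilon> / 2"
        using avg[OF C, of "\<epsilon> / 2"] \<open>0 < \<epsilon>\<close> by auto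
      have "\<bar>prob (A \<inter> C) - c * prob A\<bar> \<le> \<epsilon> / 2"
        using invariant_Int_average[OF A inv mC N(1), of c] N(2) by linarith
      moreover have "\<bar>prob C - c\<bar> \<le> \<epsilon> / 2"
        using invariant_Int_average[of UNIV C N c] N mC prob_space by (simp add: space_eq sets.top[of configs, simplified])
      then have "\<bar>prob A * (prob C - c)\<bar> \<le> 1 * (\<epsilon> / 2)"
        unfolding abs_mult by (intro mult_mono) auto
      moreover have "prob (A \<inter> C) - prob A * prob C = (prob (A \<inter> C) - c * prob A) - prob A * (prob C - c)"
        by (simp add: algebra_simps)
      ultimately show ?thesis by linarith
    qed
    then have "\<bar>prob (A \<inter> C) - prob A * prob C\<bar> \<le> 0" by (rule field_le_epsilon)
    then show ?thesis by simp
  qed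
  \<comment> \<open>The hypothesis \<open>avg\<close> concerns sets determined by coordinates from
    \<open>0\<close> on. Shifting by \<open>M\<close> moves all of \<open>I\<close> there and leaves
    \<open>A\<close> unchanged.\<close>
  have loc: "prob (A \<inter> C) = prob A * prob C" if "C \<in> local_sets" for C
  proof -
    obtain I where I: "finite I" "determined_by I C" using \<open>C \<in> local_sets\<close> by (auto simp: local_sets_def)
    obtain M :: nat where M: "\<And>i. i \<in> I \<Longrightarrow> \<bar>i\<bar> < int M"
    proof
      fix i assume "i \<in> I"
      then have "\<bar>i\<bar> \<le> (\<Sum>j\<in>I. \<bar>j\<bar>)" using I(1) by (intro member_le_sum) auto
      then show "\<bar>i\<bar> < int (nat (\<Sum>j\<in>I. \<bar>j\<bar>) + 1)" by linarith
    qed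
    have "determined_by {0..<int (2 * M)} ((shift ^^ M) -` C)"
      unfolding determined_by_def
    proof (intro allI impI)
      fix x y assume eq: "\<forall>i\<in>{0..<int (2 * M)}. x i = y i" and x: "x \<in> (shift ^^ M) -` C"
      have "(shift ^^ M) x \<in> C \<longleftrightarrow> (shift ^^ M) y \<in> C"
      proof (rule determined_byD[OF I(2)])
        fix i assume "i \<in> I"
        then have "i + int M \<in> {0..<int (2 * M)}" using M[of i] by auto
        then show "(shift ^^ M) x i = (shift ^^ M) y i" using eq unfolding funpow_shift by blast
      qed
      with x show "y \<in> (shift ^^ M) -` C" by simp
    qed
    from fwd[OF this] have "prob ((shift ^^ M) -` (A \<inter> C)) = prob A * prob ((shift ^^ M) -` C)"
      using vimage_shift_funpow_invariant[OF inv] by simp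
    then show ?thesis
      using prob_shift_funpow[OF sets.Int[OF A local_sets_measurable[OF that]], of M]
        prob_shift_funpow[OF local_sets_measurable[OF that], of M] by (simp only:)
  qed
  \<comment> \<open>Independence passes to the generated sigma-algebra, which contains
    \<open>A\<close> itself.\<close>
  have "indep_set {A} local_sets"
    using A loc local_sets_measurable by (auto intro!: indep_setI simp: sets_eq)
  moreover have "Int_stable local_sets"
    using algebra_local_sets unfolding algebra_iff_Int Int_stable_def by blast
  ultimately have "indep_set (sigma_sets (space \<mu>) {A}) (sigma_sets (space \<mu>) local_sets)"
    by (intro indep_set_sigma_sets) (auto simp: Int_stable_def)
  then have "prob (A \<inter> A) = prob A * prob A"
    by (rule indep_setD) (use A in \<open>auto simp: space_eq sets_configs[symmetric]\<close>)
  then show "prob A = 0 \<or> prob A = 1" by simp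
qed

end

text \<open>A function with finitely many values and local level sets is a finite combination of
  indicators of local sets.\<close>

lemma visit_average_tendsto:
  fixes h :: "config \<Rightarrow> real"
  assumes "prob_space \<mu>" "sets \<mu> = sets configs"
    and lim: "\<And>A. A \<in> local_sets \<Longrightarrow> ((\<lambda>m. visit_freq (N m) (x m) A) \<longlongrightarrow> measure \<mu> A) G"
    and h: "finite (range h)" "\<And>v. h -` {v} \<in> local_sets"
  shows "((\<lambda>m. (\<Sum>p<N m. h ((shift ^^ p) (x m))) / N m) \<longlongrightarrow> (\<integral>y. h y \<partial>\<mu>)) G"
proof -
  interpret prob_space \<mu> by fact
  have sp: "space \<mu> = UNIV" using sets_eq_imp_space_eq[OF assms(2)] by simp
  have expand: "h y = (\<Sum>v\<in>range h. v * indicator (h -` {v}) y)" for y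
    using h(1) by (subst sum.remove[of _ "h y"]) (auto simp: indicator_def intro!: sum.neutral[symmetric])
  have "(\<integral>y. h y \<partial>\<mu>) = (\<integral>y. (\<Sum>v\<in>range h. v * indicator (h -` {v}) y) \<partial>\<mu>)"
    using expand by metis
  also have "\<dots> = (\<Sum>v\<in>range h. v * measure \<mu> (h -` {v}))"
    using local_sets_measurable[OF h(2)]
    by (subst Bochner_Integration.integral_sum)
      (auto simp: assms(2) sp emeasure_eq_measure intro!: integrable_mult_right integrable_real_indicator)
  finally have int: "(\<integral>y. h y \<partial>\<mu>) = (\<Sum>v\<in>range h. v * measure \<mu> (h -` {v}))" .
  have freq: "visit_freq n y A = (\<Sum>p<n. indicator A ((shift ^^ p) y)) / n" for n y A
    by (simp add: visit_freq_def indicator_def sum.If_cases Int_def)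
  have "(\<Sum>p<N m. h ((shift ^^ p) (x m))) / N m = (\<Sum>v\<in>range h. v * visit_freq (N m) (x m) (h -` {v}))" for m
  proof -
    have "(\<Sum>p<N m. h ((shift ^^ p) (x m))) =
        (\<Sum>p<N m. \<Sum>v\<in>range h. v * indicator (h -` {v}) ((shift ^^ p) (x m)))"
      by (rule sum.cong[OF refl expand])
    also have "\<dots> = (\<Sum>v\<in>range h. \<Sum>p<N m. v * indicator (h -` {v}) ((shift ^^ p) (x m)))"
      by (rule sum.swap)
    finally show ?thesis by (simp only: freq times_divide_eq_right sum_distrib_left sum_divide_distrib)
  qed
  then show ?thesis unfolding int using h(2) by (auto intro!: tendsto_sum tendsto_mult lim)
qed

text \<open>The deviation depends only on which of the first \<open>N\<close> times are visits. It
  is thus an admissible \<open>h\<close> in \<open>visit_average_tendsto\<close>, which carries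
  \<open>block_averages\<close> over to the limit measure.\<close>

lemma average_deviation_local:
  fixes N :: nat and c :: real
  assumes C: "determined_by {0..<int w} C"
  defines "h \<equiv> \<lambda>x. \<bar>(\<Sum>i<N. visits C x i) / real N - c\<bar>"
  shows "finite (range h)" "h -` {v} \<in> local_sets"
proof -
  have "h x = \<bar>real (card {i. i < N \<and> (shift ^^ i) x \<in> C}) / real N - c\<bar>" for x
    by (simp add: h_def visits_def indicator_def sum.If_cases Int_def)
  then have "range h \<subseteq> (\<lambda>S. \<bar>real (card S) / real N - c\<bar>) ` Pow {..<N}" by fastforce
  then show "finite (range h)" by (rule finite_subset) simp
  have "determined_by {0..<int (w + N)} (h -` {v})"
    unfolding determined_by_def
  proof (intro allI impI)
    fix x y assume eq: "\<forall>i\<in>{0..<int (w + N)}. x i = y i" and x: "x \<in> h -` {v}"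
    have "visits C x i = visits C y i" if "i < N" for i
    proof -
      have "(shift ^^ i) x \<in> C \<longleftrightarrow> (shift ^^ i) y \<in> C"
      proof (rule determined_byD[OF C])
        fix k assume "k \<in> {0..<int w}"
        then have "k + int i \<in> {0..<int (w + N)}" using that by auto
        then show "(shift ^^ i) x k = (shift ^^ i) y k" using eq unfolding funpow_shift by blast
      qed
      then show ?thesis by (simp add: visits_def indicator_def)
    qed
    then have "h x = h y" by (simp add: h_def)
    with x show "y \<in> h -` {v}" by simp
  qed
  then show "h -` {v} \<in> local_sets" by (auto simp: local_sets_def)
qed

lemma visits_funpow: "visits C ((shift ^^ p) x) i = visits C x (p + i)"
  by (simp add: visits_def funpow_add[of i p] add.commute[of p i])

section \<open>Convergence on cylinders\<close>

lemma measure_mixture_cylinder: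
  assumes "0 \<le> \<alpha>" "\<alpha> \<le> 1"
  shows "measure (mixture \<alpha> (dirac_const 0) (dirac_const 1)) (cylinder u) =
    \<alpha> * of_bool (\<forall>i<length u. u ! i = 0) + (1 - \<alpha>) * of_bool (\<forall>i<length u. u ! i = 1)"
proof -
  have dirac: "emeasure (dirac_const a) (cylinder u) = ennreal (of_bool (\<forall>i<length u. u ! i = a))" for a
    unfolding dirac_const_def by (subst emeasure_return[OF sets_cylinder]) (auto simp: cylinder_def indicator_def)
  have "emeasure (mixture \<alpha> (dirac_const 0) (dirac_const 1)) (cylinder u) =
      ennreal \<alpha> * emeasure (dirac_const 0) (cylinder u) + ennreal (1 - \<alpha>) * emeasure (dirac_const 1) (cylinder u)"
    by (rule emeasure_mixture) (auto simp: dirac_const_def)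
  also have "\<dots> = ennreal (\<alpha> * of_bool (\<forall>i<length u. u ! i = 0) + (1 - \<alpha>) * of_bool (\<forall>i<length u. u ! i = 1))"
    using assms unfolding dirac by (simp add: ennreal_mult ennreal_plus)
  finally show ?thesis using assms by (simp add: measure_def del: ennreal_plus)
qed

lemma cylinder_disjoint:
  assumes "length u = length v" "u \<noteq> v"
  shows "cylinder u \<inter> cylinder v = {}"
proof (rule ccontr)
  assume "cylinder u \<inter> cylinder v \<noteq> {}"
  then have "\<forall>i<length u. u ! i = v ! i" using assms(1) by (force simp: cylinder_def)
  then show False using assms by (simp add: list_eq_iff_nth_eq)
qed

text \<open>Lower bounds suffice because their limits exhaust the total mass: \<open>X\<close> is
  squeezed between \<open>x\<close> and \<open>1 - y\<close>.\<close>

lemma tendsto_of_lower_bounds: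
  fixes X Y x y :: "nat \<Rightarrow> real"
  assumes "x \<longlonglongrightarrow> a" "y \<longlonglongrightarrow> 1 - a"
    and "\<forall>\<^sub>F n in sequentially. x n \<le> X n" "\<forall>\<^sub>F n in sequentially. y n \<le> Y n"
    and "\<And>n. X n + Y n \<le> 1"
  shows "X \<longlonglongrightarrow> a"
proof (rule tendsto_sandwich[OF assms(3) _ assms(1)])
  show "\<forall>\<^sub>F n in sequentially. X n \<le> 1 - y n"
    using assms(4) by eventually_elim (use assms(5) in \<open>smt (verit)\<close>)
  show "(\<lambda>n. 1 - y n) \<longlonglongrightarrow> a"
    using tendsto_diff[OF tendsto_const[of 1] assms(2)] by simp
qed

theorem theorem3:
  fixes \<alpha> :: real
  assumes "0 \<le> \<alpha>" "\<alpha> \<le> 1"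
  shows "\<exists>\<mu>. config_measure \<mu> \<and> shift_invariant \<mu> \<and> shift_ergodic \<mu> \<and> full_support \<mu> \<and>
    weak_star_converges
      (\<lambda>n. distr \<mu> configs (xor_ca ^^ (2 ^ (n * (n + 1) div 2))))
      (mixture \<alpha> (dirac_const 0) (dirac_const 1))"
proof -
  \<comment> \<open>\<open>\<beta>\<close> is the frequency of sign changes between neighbouring
    slots, and these produce the symbol \<open>1\<close>.\<close>
  define \<beta> where "\<beta> = 1 - \<alpha>"
  have \<beta>: "0 \<le> \<beta>" "\<beta> \<le> 1" using assms by (auto simp: \<beta>_def)
  obtain G \<mu> where G: "G \<noteq> bot" "G \<le> sequentially"
    and \<mu>: "config_measure \<mu>" "shift_invariant \<mu>"
    and lim: "\<And>A. A \<in> local_sets \<Longrightarrow>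
      ((\<lambda>m. visit_freq (block_len m) (block_config \<beta> m 0) A) \<longlongrightarrow> measure \<mu> A) G"
    using ex_empirical_limit[OF block_len_tendsto, of "\<lambda>m. block_config \<beta> m 0"] by blast
  have prob: "prob_space \<mu>" and sets: "sets \<mu> = sets configs"
    using \<mu> by (auto simp: config_measure_def)
  interpret stationary \<mu>
    using \<mu> prob sets by (intro stationary.intro stationary_axioms.intro) (auto simp: shift_invariant_def)
  \<comment> \<open>Estimates valid for all late \<open>m\<close> hold along \<open>G\<close> and
    hence pass to \<open>\<mu>\<close>.\<close>
  have ev: "\<forall>\<^sub>F m in G. P m" if "\<forall>\<^sub>F m in sequentially. P m" for P
    using that G(2) by (rule filter_leD[rotated])
  have "shift_ergodic \<mu>"
  proof (rule ergodic_of_averages)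
    fix C w and \<epsilon> :: real assume C: "determined_by {0..<int w} C" and "0 < \<epsilon>"
    then obtain N c where N: "0 < N" and le: "\<forall>\<^sub>F m in sequentially.
      (\<Sum>p<block_len m. \<bar>(\<Sum>i<N. visits C (block_config \<beta> m 0) (p + i)) / real N - c\<bar>) / block_len m \<le> \<epsilon>"
      using block_averages[of w C \<epsilon> \<beta>] by blast
    have "(\<integral>x. \<bar>(\<Sum>i<N. visits C x i) / real N - c\<bar> \<partial>\<mu>) \<le> \<epsilon>"
      by (rule tendsto_upperbound[OF visit_average_tendsto[OF prob sets lim average_deviation_local[OF C]] _ G(1)])
        (assumption, rule ev[OF le[folded visits_funpow]])
    with N show "\<exists>N c. 0 < N \<and> (\<integral>x. \<bar>(\<Sum>i<N. visits C x i) / real N - c\<bar> \<partial>\<mu>) \<le> \<epsilon>" by blast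
  qed
  moreover have "full_support \<mu>"
    unfolding full_support_def
  proof
    fix u
    obtain n where n: "0 < n" and visit: "\<And>s. \<exists>r. r + length u \<le> block_len n \<and> r < block_len n \<and>
        (shift ^^ r) (block_config \<beta> n s) \<in> cylinder u"
      using block_contains_word[of u \<beta>] by blast
    \<comment> \<open>A single visit per good tile already gives a positive lower bound on the
      frequency, uniformly in \<open>m \<ge> n\<close>.\<close>
    have one: "1 \<le> card {r. r + length u \<le> block_len n \<and> r < block_len n \<and>
        (shift ^^ r) (block_config \<beta> n s) \<in> cylinder u}" for s
      using visit[of s] unfolding One_nat_def Suc_le_eq card_gt_0_iff by auto
    have "(1 - 1 / 2 ^ n) * (real 1 / real (block_len n)) \<le> measure \<mu> (cylinder u)"
      by (rule tendsto_lowerbound[OF lim[OF cylinder_local] ev[OF eventually_mono[OF eventually_ge_at_top[of n]]] G(1)])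
        (rule visit_freq_block_ge[OF _ determined_by_cylinder one])
    moreover have "(1 :: real) < 2 ^ n" using n by (simp add: one_less_power)
    then have "0 < (1 - 1 / 2 ^ n) * (real 1 / real (block_len n))" by simp
    ultimately show "0 < measure \<mu> (cylinder u)" by linarith
  qed
  moreover have "weak_star_converges
      (\<lambda>n. distr \<mu> configs (xor_ca ^^ (2 ^ (n * (n + 1) div 2))))
      (mixture \<alpha> (dirac_const 0) (dirac_const 1))"
    unfolding weak_star_converges_def block_len_def[symmetric]
  proof
    fix u :: "bit list"
    define k where "k = length u"
    define X where "X v n = measure \<mu> ((xor_ca ^^ block_len n) -` cylinder v)" for v n
    define zeros where "zeros = replicate k (0 :: bit)"
    define ones where "ones = replicate k (1 :: bit)"
    have distr: "measure (distr \<mu> configs (xor_ca ^^ block_len n)) (cylinder u) = X u n" for n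
      unfolding X_def using measurable_xor_ca_funpow[of "block_len n"] measurable_cong_sets[OF sets refl, of configs]
      by (subst measure_distr) (auto simp: space_eq)
    have meas: "(xor_ca ^^ block_len n) -` cylinder v \<in> sets \<mu>" for v n
      using measurable_sets[OF measurable_xor_ca_funpow sets_cylinder] by (simp add: sets)
    define b where "b \<gamma> n = (1 - 1 / 2 ^ Suc n) * ((\<gamma> - 5 / 2 ^ Suc n) * (1 - real k / block_len n))" for \<gamma> n
    have b_lim: "b \<gamma> \<longlonglongrightarrow> \<gamma>" for \<gamma>
    proof -
      have pow: "(\<lambda>n. c / 2 ^ Suc n) \<longlonglongrightarrow> 0" for c :: real
        by (rule LIMSEQ_Suc[OF LIMSEQ_divide_realpow_zero]) simp
      have "(\<lambda>n. real k / block_len n) \<longlonglongrightarrow> 0"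
        by (intro tendsto_divide_0[OF tendsto_const] filterlim_at_top_imp_at_infinity
            filterlim_compose[OF filterlim_real_sequentially block_len_tendsto])
      then have "b \<gamma> \<longlonglongrightarrow> (1 - 0) * ((\<gamma> - 0) * (1 - 0))"
        unfolding b_def by (intro tendsto_intros pow)
      then show ?thesis by simp
    qed
    \<comment> \<open>Here \<open>n\<close> is fixed while \<open>m\<close> runs along
      \<open>G\<close>; this is possible because the preimage is a local set. Only afterwards does
      \<open>n\<close> tend to infinity.\<close>
    have b_le: "\<forall>\<^sub>F n in sequentially. b (if a = 1 then \<beta> else 1 - \<beta>) n \<le> X (replicate k a) n" for a
      using eventually_ge_at_top[of k]
    proof eventually_elim
      case (elim n)
      then have k: "k \<le> block_len n" using less_block_len[of n] by linarith
      have "(xor_ca ^^ block_len n) -` cylinder (replicate k a) \<in> local_sets"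
        unfolding local_sets_def
        using determined_by_xor_ca_funpow[OF determined_by_cylinder, of "replicate k a" n] by blast
      from lim[OF this] show ?case
        unfolding X_def b_def
        by (rule tendsto_lowerbound[OF _ ev[OF eventually_mono[OF eventually_ge_at_top[of "Suc n"]]] G(1)])
          (rule visit_freq_xor_const[OF \<beta> k])
    qed
    have zeros_le: "\<forall>\<^sub>F n in sequentially. b \<alpha> n \<le> X zeros n"
      using b_le[of 0] by (simp add: zeros_def \<beta>_def)
    have ones_le: "\<forall>\<^sub>F n in sequentially. b (1 - \<alpha>) n \<le> X ones n"
      using b_le[of 1] by (simp add: ones_def \<beta>_def)
    have same: "(\<forall>i<length u. u ! i = a) \<longleftrightarrow> u = replicate k a" for a
      by (auto simp: k_def list_eq_iff_nth_eq)
    have disj: "(xor_ca ^^ block_len n) -` cylinder v \<inter> (xor_ca ^^ block_len n) -` cylinder v' = {}"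
      if "length v = length v'" "v \<noteq> v'" for v v' n
      using cylinder_disjoint[OF that] by blast
    \<comment> \<open>For the empty word \<open>zeros = ones\<close>, and the two weights add up to
      \<open>1\<close>.\<close>
    have "X u \<longlonglongrightarrow> \<alpha> * of_bool (u = zeros) + (1 - \<alpha>) * of_bool (u = ones)"
    proof (cases "k = 0")
      case True
      then have "cylinder u = UNIV" "u = []" by (auto simp: cylinder_def k_def)
      moreover from this have "X u = (\<lambda>n. 1)" using prob_space by (simp add: X_def space_eq fun_eq_iff)
      ultimately show ?thesis by (simp add: zeros_def ones_def True)
    next
      case False
      then have ne: "zeros \<noteq> ones" by (cases k) (auto simp: zeros_def ones_def)
      have two: "X zeros n + X ones n \<le> 1" for n
      proof -
        have "length zeros = length ones" by (simp add: zeros_def ones_def)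
        from finite_measure_Union[OF meas meas disj[OF this ne, of n]] show ?thesis
          unfolding X_def by (metis prob_le_1)
      qed
      consider "u = zeros" | "u = ones" | "u \<noteq> zeros" "u \<noteq> ones" by blast
      then show ?thesis
      proof cases
        case 1
        then show ?thesis
          using tendsto_of_lower_bounds[OF b_lim b_lim zeros_le ones_le two] ne by simp
      next
        case 2
        have "b \<alpha> \<longlonglongrightarrow> 1 - (1 - \<alpha>)" using b_lim[of \<alpha>] by simp
        from tendsto_of_lower_bounds[OF b_lim this ones_le zeros_le] two ne 2 show ?thesis
          by (simp add: add.commute)
      next
        case 3
        \<comment> \<open>The two constant words take up all the mass in the limit, and
          \<open>u\<close> is disjoint from both, so nothing is left for it.\<close>
        have three: "X u n + (X zeros n + X ones n) \<le> 1" for n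
        proof -
          let ?f = "\<lambda>v. (xor_ca ^^ block_len n) -` cylinder v"
          have "X zeros n + X ones n = measure \<mu> (?f zeros \<union> ?f ones)"
            unfolding X_def by (rule finite_measure_Union[symmetric, OF meas meas disj[OF _ ne]])
              (simp add: zeros_def ones_def)
          moreover have "X u n + measure \<mu> (?f zeros \<union> ?f ones) = measure \<mu> (?f u \<union> (?f zeros \<union> ?f ones))"
            unfolding X_def using 3 disj[of u zeros n] disj[of u ones n]
            by (intro finite_measure_Union[symmetric] meas sets.Un) (auto simp: zeros_def ones_def k_def)
          ultimately show ?thesis using prob_le_1 by metis
        qed
        have "(\<lambda>n. 1 - (b \<alpha> n + b (1 - \<alpha>) n)) \<longlonglongrightarrow> 1 - (\<alpha> + (1 - \<alpha>))"
          by (intro tendsto_intros b_lim)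
        then have "X u \<longlonglongrightarrow> 0"
        proof (intro tendsto_sandwich[of "\<lambda>_. 0" "X u" sequentially "\<lambda>n. 1 - (b \<alpha> n + b (1 - \<alpha>) n)"])
          show "\<forall>\<^sub>F n in sequentially. X u n \<le> 1 - (b \<alpha> n + b (1 - \<alpha>) n)"
            using zeros_le ones_le by eventually_elim (use three in \<open>smt (verit)\<close>)
        qed (auto simp: X_def)
        then show ?thesis using 3 by simp
      qed
    qed
    then show "(\<lambda>n. measure (distr \<mu> configs (xor_ca ^^ block_len n)) (cylinder u))
        \<longlonglongrightarrow> measure (mixture \<alpha> (dirac_const 0) (dirac_const 1)) (cylinder u)"
      unfolding distr measure_mixture_cylinder[OF assms] same zeros_def ones_def .
  qed
  ultimately show ?thesis using \<mu> by blast
qed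

end
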